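(* Let $\mathbb{F}$ be a local field and $n$ a positive integer. Then $\mathrm{PGL}(n,\mathbb{F})$ is totally minimal.
   Context: A local field is a non-discrete locally compact (Hausdorff) topological field; no restriction on the characteristic is made. $\mathrm{GL}(n,\mathbb{F})$ is the group of invertible $n\times n$ matrices with the pointwise topology inherited from $\mathbb{F}^{n^2}$, and $\mathrm{PGL}(n,\mathbb{F})=\mathrm{GL}(n,\mathbb{F})/Z(\mathrm{GL}(n,\mathbb{F}))$, where $Z$ denotes the center, with the quotient topology. All topological groups are Hausdorff. A topological group is minimal if it admits no strictly coarser Hausdorff group topology; $G$ is totally minimal if every Hausdorff quotient group $G/N$ ($N$ a closed normal subgroup) is minimal. *)

theory Defs
  imports "HOL-Analysis.Analysis" "HOL-Algebra.Coset"
begin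

section \<open>Local fields\<close>

class topological_field = field + topological_ab_group_add + topological_comm_monoid_mult +
  assumes tendsto_inverse_nhds: "a \<noteq> 0 \<Longrightarrow> (inverse \<longlongrightarrow> inverse a) (nhds a)"

text \<open>No assumption on the characteristic is made. The term \<open>topology open\<close> is the
  unfolding of the abbreviation \<open>euclidean\<close>, which cannot be used inside a class specification.\<close>

class local_field = topological_field + t2_space +
  assumes locally_compact_UNIV: "locally_compact_space (topology open)"
    and nondiscrete: "topology open \<noteq> discrete_topology UNIV"


section \<open>Quotient topologies\<close>

definition quotient_topology :: "'a topology \<Rightarrow> ('a \<Rightarrow> 'b) \<Rightarrow> 'b topology" where
  "quotient_topology X f =
     topology (\<lambda>U. U \<subseteq> f ` topspace X \<and> openin X {x \<in> topspace X. f x \<in> U})"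

lemma openin_quotient_topology:
  "openin (quotient_topology X f) U \<longleftrightarrow>
     U \<subseteq> f ` topspace X \<and> openin X {x \<in> topspace X. f x \<in> U}"
proof -
  have "istopology (\<lambda>U. U \<subseteq> f ` topspace X \<and> openin X {x \<in> topspace X. f x \<in> U})"
    unfolding istopology_def
  proof (intro conjI allI impI)
    fix S T
    assume "S \<subseteq> f ` topspace X \<and> openin X {x \<in> topspace X. f x \<in> S}"
      and "T \<subseteq> f ` topspace X \<and> openin X {x \<in> topspace X. f x \<in> T}"
    moreover have "{x \<in> topspace X. f x \<in> S \<inter> T} =
        {x \<in> topspace X. f x \<in> S} \<inter> {x \<in> topspace X. f x \<in> T}"
      by auto
    ultimately show "S \<inter> T \<subseteq> f ` topspace X" "openin X {x \<in> topspace X. f x \<in> S \<inter> T}"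
      by (auto simp: openin_Int)
  next
    fix \<K>
    assume *: "\<forall>K\<in>\<K>. K \<subseteq> f ` topspace X \<and> openin X {x \<in> topspace X. f x \<in> K}"
    have "{x \<in> topspace X. f x \<in> \<Union>\<K>} = (\<Union>K\<in>\<K>. {x \<in> topspace X. f x \<in> K})"
      by auto
    with * show "\<Union>\<K> \<subseteq> f ` topspace X" "openin X {x \<in> topspace X. f x \<in> \<Union>\<K>}"
      by (auto intro!: openin_Union)
  qed
  then show ?thesis
    by (simp add: quotient_topology_def)
qed

lemma topspace_quotient_topology [simp]:
  "topspace (quotient_topology X f) = f ` topspace X"
proof (rule antisym)
  have "{x \<in> topspace X. f x \<in> f ` topspace X} = topspace X"
    by auto
  then have "openin (quotient_topology X f) (f ` topspace X)"
    by (simp add: openin_quotient_topology)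
  then show "f ` topspace X \<subseteq> topspace (quotient_topology X f)"
    by (rule openin_subset)
qed (use openin_quotient_topology[of X f] openin_topspace in blast)

lemma quotient_map_quotient_topology: "quotient_map X (quotient_topology X f) f"
  by (auto simp: quotient_map_def openin_quotient_topology)


section \<open>Topological groups\<close>

text \<open>Topological groups are Hausdorff by convention.\<close>

definition topological_group :: "('a, 'b) monoid_scheme \<Rightarrow> 'a topology \<Rightarrow> bool" where
  "topological_group G T \<longleftrightarrow>
     group G \<and> topspace T = carrier G \<and> Hausdorff_space T \<and>
     continuous_map (prod_topology T T) T (\<lambda>(x, y). x \<otimes>\<^bsub>G\<^esub> y) \<and>
     continuous_map T T (\<lambda>x. inv\<^bsub>G\<^esub> x)"

definition coarser_topology :: "'a topology \<Rightarrow> 'a topology \<Rightarrow> bool" where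
  "coarser_topology S T \<longleftrightarrow> (\<forall>U. openin S U \<longrightarrow> openin T U)"

definition minimal_group :: "('a, 'b) monoid_scheme \<Rightarrow> 'a topology \<Rightarrow> bool" where
  "minimal_group G T \<longleftrightarrow>
     topological_group G T \<and>
     \<not> (\<exists>S. topological_group G S \<and> coarser_topology S T \<and> S \<noteq> T)"

definition quotient_group_topology ::
    "('a, 'b) monoid_scheme \<Rightarrow> 'a topology \<Rightarrow> 'a set \<Rightarrow> 'a set topology" where
  "quotient_group_topology G T N = quotient_topology T (\<lambda>x. N #>\<^bsub>G\<^esub> x)"

definition totally_minimal_group :: "('a, 'b) monoid_scheme \<Rightarrow> 'a topology \<Rightarrow> bool" where
  "totally_minimal_group G T \<longleftrightarrow>
     topological_group G T \<and>
     (\<forall>N. N \<lhd> G \<and> closedin T N \<longrightarrow>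
        minimal_group (G Mod N) (quotient_group_topology G T N))"

definition group_center :: "('a, 'b) monoid_scheme \<Rightarrow> 'a set" where
  "group_center G = {z \<in> carrier G. \<forall>g\<in>carrier G. z \<otimes>\<^bsub>G\<^esub> g = g \<otimes>\<^bsub>G\<^esub> z}"


section \<open>General and projective linear groups\<close>

text \<open>The size of the matrices is \<open>CARD('n)\<close>. The topology on the type of
  matrices is the product topology.\<close>

definition GL :: "('a::field ^ 'n ^ 'n) monoid" where
  "GL = \<lparr>carrier = {A. invertible A}, mult = (**), one = mat 1\<rparr>"

definition GL_topology :: "('a::topological_field ^ 'n ^ 'n) topology" where
  "GL_topology = subtopology euclidean (carrier GL)"

definition PGL :: "('a::field ^ 'n ^ 'n) set monoid" where
  "PGL = GL Mod group_center GL"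

definition PGL_topology :: "('a::topological_field ^ 'n ^ 'n) set topology" where
  "PGL_topology = quotient_group_topology GL GL_topology (group_center GL)"

end

theory Submission
  imports Defs
begin

text \<open>Let \<open>h\<close> be the projection of GL onto a Hausdorff quotient of PGL, and suppose that
  \<open>h g \<rightarrow> q\<close> in a coarser Hausdorff group topology. Since scalars lie in the kernel, \<open>g\<close> can be
  rescaled into a compact set of nonzero matrices, so one may assume \<open>g \<rightarrow> A \<noteq> 0\<close>. If \<open>A\<close> is invertible,
  then \<open>h g \<rightarrow> h A\<close> in the original topology and \<open>h A = q\<close>. If \<open>A\<close> is singular, conjugation by
  \<open>g\<close> expands some matrices close to \<open>1\<close> to transvections that stay away from \<open>1\<close>, so the kernel of \<open>h\<close>
  contains a transvection, hence all of them. Then \<open>h g\<close> depends only on the determinant of \<open>g\<close>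
  modulo \<open>n\<close>-th powers, and \<open>F\<^sup>* / (F\<^sup>*)\<^sup>n\<close> is covered by a compact set of representatives, so
  \<open>h g\<close> again converges to \<open>q\<close> in the original topology. No absolute value on the field is needed: it
  is replaced by a compact neighbourhood of \<open>0\<close> and an element \<open>t\<close> with \<open>t ^ k \<rightarrow> 0\<close>.\<close>

section \<open>Compactness in local fields\<close>

text \<open>\<open>l\<close> is a cluster point of \<open>f\<close> along \<open>F\<close>, and
  \<open>G\<close> refines \<open>F\<close> by the preimages of the neighbourhoods of
  \<open>l\<close>. Filters replace sequences because the coarser group topology need not be first
  countable.\<close>

lemma compact_obtain_subfilter:
  assumes "compact K" "F \<noteq> bot" "eventually (\<lambda>x. f x \<in> K) F"
  obtains l G where "l \<in> K" "G \<noteq> bot" "G \<le> F" "(f \<longlongrightarrow> l) G"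
proof -
  have "filtermap f F \<noteq> bot" "eventually (\<lambda>y. y \<in> K) (filtermap f F)"
    using assms by (auto simp: filtermap_bot_iff eventually_filtermap)
  with \<open>compact K\<close> obtain l where l: "l \<in> K" "inf (nhds l) (filtermap f F) \<noteq> bot"
    unfolding compact_filter by blast
  let ?G = "inf F (filtercomap f (nhds l))"
  have "?G \<noteq> bot"
  proof
    assume "?G = bot"
    then have "eventually (\<lambda>_. False) ?G"
      by simp
    then obtain P Q where "eventually P F" and Q: "eventually Q (nhds l)"
      and PQ: "\<And>x. P x \<Longrightarrow> Q (f x) \<Longrightarrow> False"
      unfolding eventually_inf eventually_filtercomap by metis
    have "eventually (\<lambda>y. \<not> Q y) (filtermap f F)"
      unfolding eventually_filtermap by (rule eventually_mono[OF \<open>eventually P F\<close>]) (use PQ in blast)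
    with Q have "eventually (\<lambda>_. False) (inf (nhds l) (filtermap f F))"
      unfolding eventually_inf by blast
    with l(2) show False
      by (simp add: eventually_False)
  qed
  moreover have "(f \<longlongrightarrow> l) ?G"
    by (rule filterlim_mono[OF filterlim_filtercomap order_refl]) simp
  ultimately show thesis
    using that[of l ?G] l(1) by simp
qed

text \<open>Tychonoff's theorem for functions, transported by the continuous map
  \<open>vec_lambda\<close>.\<close>

lemma compact_vec_box:
  fixes V :: "'a::topological_space set"
  assumes "compact V"
  shows "compact {x::'a^'n. \<forall>i. x $ i \<in> V}"
proof -
  have "compactin (product_topology (\<lambda>_. euclidean) UNIV) (PiE UNIV (\<lambda>_::'n. V))"
    using assms by (simp add: compactin_PiE)
  then have "compact (PiE UNIV (\<lambda>_::'n. V))"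
    by (simp add: euclidean_product_topology)
  moreover have "continuous_on (PiE UNIV (\<lambda>_::'n. V)) vec_lambda"
    unfolding continuous_on_def
  proof (intro ballI vec_tendstoI)
    fix f i
    assume "f \<in> PiE UNIV (\<lambda>_::'n. V)"
    moreover have "continuous_on (PiE UNIV (\<lambda>_::'n. V)) (\<lambda>f. f i)"
      using continuous_on_product_coordinates continuous_on_subset subset_UNIV by metis
    ultimately show "((\<lambda>f. vec_lambda f $ i) \<longlongrightarrow> vec_lambda f $ i) (at f within PiE UNIV (\<lambda>_::'n. V))"
      by (simp add: continuous_on_def)
  qed
  ultimately have "compact (vec_lambda ` (PiE UNIV (\<lambda>_::'n. V)))"
    by (rule compact_continuous_image[rotated])
  moreover have "vec_lambda ` (PiE UNIV (\<lambda>_::'n. V)) = {x. \<forall>i. x $ i \<in> V}"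
  proof -
    have "x \<in> vec_lambda ` (PiE UNIV (\<lambda>_::'n. V))" if "\<forall>i. x $ i \<in> V" for x :: "'a^'n"
      using that by (intro image_eqI[of _ _ "vec_nth x"]) (auto simp: vec_nth_inverse)
    then show ?thesis by auto
  qed
  ultimately show ?thesis by simp
qed

section \<open>Elements whose powers tend to zero\<close>

lemma tendsto_inverse_topological_field:
  fixes a :: "'a::topological_field"
  assumes "(f \<longlongrightarrow> a) F" "a \<noteq> 0"
  shows "((\<lambda>x. inverse (f x)) \<longlongrightarrow> inverse a) F"
  using filterlim_compose[OF tendsto_inverse_nhds assms(1)] assms(2) by simp

lemma local_field_compact_nhd_0:
  obtains V :: "'a::local_field set" where "compact V" "0 \<in> interior V"
proof -
  have "\<exists>U K. open U \<and> compact K \<and> 0 \<in> U \<and> U \<subseteq> (K :: 'a set)"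
    using locally_compact_UNIV[where 'a='a] unfolding locally_compact_space_def by simp
  then obtain U K :: "'a set" where "open U" "compact K" "0 \<in> U" "U \<subseteq> K"
    by blast
  then show thesis
    using that[of K] interior_maximal[of U K] by blast
qed

text \<open>If 0 were isolated, translations would make every point isolated, and the topology would
  be discrete.\<close>

lemma local_field_at_0_neq_bot: "at (0::'a::local_field) \<noteq> bot"
proof
  assume "at (0::'a) = bot"
  then have "open {0::'a}"
    by (simp add: at_eq_bot_iff)
  have "open {a}" for a :: 'a
  proof -
    have "continuous_on UNIV (\<lambda>x. x - a)"
      by (intro continuous_intros)
    then have "open ((\<lambda>x. x - a) -` {0})"
      using \<open>open {0}\<close> by (simp add: open_vimage)
    moreover have "(\<lambda>x. x - a) -` {0} = {a}" by auto
    ultimately show ?thesis by simp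
  qed
  then have "open S" for S :: "'a set"
    using open_UN[of S "\<lambda>a. {a}"] by simp
  then have "(euclidean :: 'a topology) = discrete_topology UNIV"
    by (simp add: topology_eq)
  with nondiscrete show False by blast
qed

text \<open>Recurrence: if a nonzero \<open>x\<close> were a cluster point of the powers of \<open>t\<close>, then
  \<open>t ^ (k - l)\<close> would accumulate at \<open>1\<close> for \<open>k > l\<close>, and \<open>v\<close> would be a limit of points of \<open>t V\<close>.\<close>

lemma power_tendsto_0_if_contracting:
  fixes t v :: "'a::local_field"
  assumes V: "compact V" "0 \<in> interior V" and tV: "\<And>x. x \<in> V \<Longrightarrow> t * x \<in> V"
    and v: "v \<in> V" "v \<notin> (\<lambda>x. t * x) ` V" and "t \<noteq> 0"
  shows "(\<lambda>k. t ^ k) \<longlonglongrightarrow> 0"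
proof -
  have "v \<noteq> 0"
    using v V(2) interior_subset by force
  have pV: "t ^ k * x \<in> V" if "x \<in> V" for k x
    by (induction k) (auto simp: that tV mult.assoc)
  have clV: "closed ((\<lambda>x. t * x) ` V)"
    by (intro compact_imp_closed compact_continuous_image V continuous_intros)
  show ?thesis
  proof (rule ccontr)
    assume "\<not> (\<lambda>k. t ^ k) \<longlonglongrightarrow> 0"
    \<comment> \<open>The powers are multiplied by \<open>v\<close> because the orbit of
      \<open>v\<close> stays in the compact set \<open>V\<close>.\<close>
    have "\<not> (\<lambda>k. t ^ k * v) \<longlonglongrightarrow> 0"
    proof
      assume "(\<lambda>k. t ^ k * v) \<longlonglongrightarrow> 0"
      then have "(\<lambda>k. t ^ k * v * inverse v) \<longlonglongrightarrow> 0 * inverse v"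
        by (intro tendsto_intros)
      with \<open>\<not> (\<lambda>k. t ^ k) \<longlonglongrightarrow> 0\<close> \<open>v \<noteq> 0\<close> show False
        by (simp add: mult.assoc)
    qed
    then obtain U where U: "open U" "0 \<in> U" "\<not> eventually (\<lambda>k. t ^ k * v \<in> U) sequentially"
      unfolding tendsto_def by blast
    let ?F = "inf sequentially (principal {k. t ^ k * v \<notin> U})"
    have "?F \<noteq> bot"
      using U(3) by (simp add: eventually_inf_principal flip: eventually_False)
    moreover have "eventually (\<lambda>k. t ^ k * v \<in> V - U) ?F"
      by (simp add: eventually_inf_principal pV v)
    ultimately obtain x G where x: "x \<in> V - U" and G: "G \<noteq> bot" "G \<le> ?F"
      and lim: "((\<lambda>k. t ^ k * v) \<longlongrightarrow> x) G"
      by (rule compact_obtain_subfilter[OF compact_diff[OF V(1) U(1)]])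
    have "x \<noteq> 0" using x U by blast
    \<comment> \<open>For \<open>k > l\<close>, dividing \<open>t ^ k * v\<close> by
      \<open>t ^ l\<close> leaves \<open>t\<close> times a point of the orbit; the image of
      \<open>V\<close> under multiplication by \<open>t\<close> is closed.\<close>
    have "inverse (t ^ l) * x \<in> (\<lambda>x. t * x) ` V" for l
    proof (rule Lim_in_closed_set[OF clV])
      show "((\<lambda>k. inverse (t ^ l) * (t ^ k * v)) \<longlongrightarrow> inverse (t ^ l) * x) G"
        by (intro tendsto_intros lim)
      have "eventually (\<lambda>k. k > l) G"
        by (rule filter_leD[OF G(2)])
          (rule le_infI1[THEN filter_leD, OF order_refl eventually_gt_at_top])
      then show "eventually (\<lambda>k. inverse (t ^ l) * (t ^ k * v) \<in> (\<lambda>x. t * x) ` V) G"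
      proof eventually_elim
        fix k assume "l < k"
        then obtain m where "k = l + Suc m"
          by (metis add_Suc_right less_iff_Suc_add)
        then have "inverse (t ^ l) * (t ^ k * v) = t * (t ^ m * v)"
          using \<open>t \<noteq> 0\<close> by (simp add: power_add)
        then show "inverse (t ^ l) * (t ^ k * v) \<in> (\<lambda>x. t * x) ` V"
          using pV v by blast
      qed
    qed (fact G)
    \<comment> \<open>The rewriting exposes \<open>t ^ l * v\<close>, so that a second limit, now in
      \<open>l\<close>, yields \<open>x * v * inverse x = v\<close>.\<close>
    moreover have "x * v * inverse (t ^ l * v) = inverse (t ^ l) * x" for l
      using \<open>v \<noteq> 0\<close> by (simp add: field_simps)
    ultimately have in_tV: "x * v * inverse (t ^ l * v) \<in> (\<lambda>x. t * x) ` V" for l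
      by metis
    have "((\<lambda>l. x * v * inverse (t ^ l * v)) \<longlongrightarrow> x * v * inverse x) G"
      by (intro tendsto_intros tendsto_inverse_topological_field lim \<open>x \<noteq> 0\<close>)
    then have "x * v * inverse x \<in> (\<lambda>x. t * x) ` V"
      by (rule Lim_in_closed_set[OF clV always_eventually[OF allI[OF in_tV]] G(1)])
    moreover have "x * v * inverse x = v"
      using \<open>x \<noteq> 0\<close> by (simp add: field_simps)
    ultimately show False
      using v by simp
  qed
qed

text \<open>Every \<open>t\<close> close to 0 maps \<open>V\<close> into itself, and some such
  \<open>t\<close> has \<open>inverse t * v\<close> outside \<open>V\<close>, so that
  \<open>v\<close> is not in the image; this is the contraction criterion.\<close>

lemma local_field_ex_power_tendsto_0:
  obtains t :: "'a::local_field" where "t \<noteq> 0" "(\<lambda>k. t ^ k) \<longlonglongrightarrow> 0"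
proof -
  obtain V :: "'a set" where V: "compact V" "0 \<in> interior V"
    using local_field_compact_nhd_0 by blast
  have at0: "((\<lambda>w::'a. w) \<longlongrightarrow> 0) (at 0)"
    by (rule tendsto_ident_at)
  \<comment> \<open>By compactness: counterexamples \<open>x w\<close> would accumulate at some
    \<open>l\<close>, and \<open>w * x w\<close> would tend to \<open>0 * l = 0\<close>, an interior
    point of \<open>V\<close>.\<close>
  have ev: "eventually (\<lambda>w. \<forall>x\<in>V. w * x \<in> V) (at 0)"
  proof (rule ccontr)
    assume *: "\<not> eventually (\<lambda>w. \<forall>x\<in>V. w * x \<in> V) (at 0)"
    define x where "x w = (SOME x. x \<in> V \<and> w * x \<notin> V)" for w
    have x: "x w \<in> V \<and> w * x w \<notin> V" if "\<not> (\<forall>x\<in>V. w * x \<in> V)" for w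
      unfolding x_def by (rule someI_ex) (use that in blast)
    let ?F = "inf (at 0) (principal {w. \<not> (\<forall>x\<in>V. w * x \<in> V)})"
    have "?F \<noteq> bot"
      using * by (simp add: eventually_inf_principal flip: eventually_False)
    moreover have "eventually (\<lambda>w. x w \<in> V) ?F"
      using x by (simp add: eventually_inf_principal)
    ultimately obtain l G where "l \<in> V" and G: "G \<noteq> bot" "G \<le> ?F" "(x \<longlongrightarrow> l) G"
      by (rule compact_obtain_subfilter[OF V(1)])
    have "((\<lambda>w. w) \<longlongrightarrow> 0) G"
      using at0 by (rule tendsto_mono[rotated]) (use G in simp)
    from tendsto_mult[OF this G(3)] have "((\<lambda>w. w * x w) \<longlongrightarrow> 0) G"
      by simp
    then have "eventually (\<lambda>w. w * x w \<in> interior V) G"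
      using V(2) by (auto simp: tendsto_def)
    moreover have "eventually (\<lambda>w. w * x w \<notin> V) G"
      by (rule filter_leD[OF G(2)]) (use x in \<open>simp add: eventually_inf_principal\<close>)
    ultimately have "eventually (\<lambda>w. False) G"
      by eventually_elim (use interior_subset in blast)
    with G(1) show False by (simp add: eventually_False)
  qed
  have ev0: "eventually (\<lambda>w. w \<noteq> 0) (at (0::'a))"
    by (simp add: eventually_at_filter)
  have "eventually (\<lambda>w. w \<in> V - {0}) (at 0)"
  proof -
    have "eventually (\<lambda>w. w \<in> interior V) (at 0)"
      using V(2) by (intro topological_tendstoD[OF at0]) auto
    with ev0 show ?thesis
      by eventually_elim (use interior_subset in blast)
  qed
  then obtain v where v: "v \<in> V" "v \<noteq> 0"
    using eventually_happens local_field_at_0_neq_bot by blast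
  \<comment> \<open>If \<open>inverse w * v\<close> stayed in \<open>V\<close>, it would accumulate
    there, and multiplying back by \<open>w\<close> would give \<open>v = 0\<close>.\<close>
  have "frequently (\<lambda>w. inverse w * v \<notin> V) (at 0)"
    unfolding frequently_def
  proof
    assume "eventually (\<lambda>w. \<not> inverse w * v \<notin> V) (at 0)"
    then have "eventually (\<lambda>w. inverse w * v \<in> V) (at 0)"
      by simp
    then obtain l G where "l \<in> V" and G: "G \<noteq> bot" "G \<le> at 0" "((\<lambda>w. inverse w * v) \<longlongrightarrow> l) G"
      by (rule compact_obtain_subfilter[OF V(1) local_field_at_0_neq_bot])
    have "((\<lambda>w. w) \<longlongrightarrow> 0) G"
      using at0 by (rule tendsto_mono[rotated]) (use G in simp)
    from tendsto_mult[OF this G(3)] have "((\<lambda>w. w * (inverse w * v)) \<longlongrightarrow> 0) G"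
      by simp
    moreover have "eventually (\<lambda>w. w * (inverse w * v) = v) G"
      by (rule filter_leD[OF G(2)]) (simp add: eventually_at_filter)
    ultimately have "((\<lambda>w. v) \<longlongrightarrow> 0) G"
      by (rule Lim_transform_eventually)
    then show False
      using G(1) v(2) by (simp add: tendsto_const_iff)
  qed
  then have "frequently (\<lambda>w. inverse w * v \<notin> V \<and> w \<noteq> 0 \<and> (\<forall>x\<in>V. w * x \<in> V)) (at 0)"
    by (rule frequently_eventually_frequently[OF _ eventually_conj[OF ev0 ev]])
  then obtain t where t: "inverse t * v \<notin> V" "t \<noteq> 0" "\<forall>x\<in>V. t * x \<in> V"
    using frequently_ex by blast
  have "v \<notin> (\<lambda>x. t * x) ` V"
    using t(1,2) by (auto simp flip: mult.assoc)
  then have "(\<lambda>k. t ^ k) \<longlonglongrightarrow> 0"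
    using power_tendsto_0_if_contracting[OF V, of t v] t v by blast
  with t show thesis using that by blast
qed

section \<open>Compact sets of representatives modulo scaling\<close>

text \<open>A high power of \<open>s\<close> brings the finite set \<open>X\<close> into
  \<open>V\<close>; then one divides by \<open>s\<close> until just before the first exit from
  \<open>V\<close>. This replaces normalising by an absolute value.\<close>

lemma scale_into_annulus:
  fixes s :: "'a::local_field"
  assumes V: "compact V" "0 \<in> interior V" and s: "s \<noteq> 0" "(\<lambda>k. s ^ k) \<longlonglongrightarrow> 0"
    and X: "finite X" "x \<in> X" "x \<noteq> 0"
  obtains k m where "\<forall>y\<in>X. s ^ k / s ^ m * y \<in> V"
    and "\<exists>y\<in>X. s ^ k / s ^ m * y / s \<notin> V"
proof -
  have "eventually (\<lambda>k. s ^ k * y \<in> V) sequentially" for y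
  proof -
    have "(\<lambda>k. s ^ k * y) \<longlonglongrightarrow> 0 * y"
      by (intro tendsto_intros s)
    then have "eventually (\<lambda>k. s ^ k * y \<in> interior V) sequentially"
      using V(2) by (simp add: tendsto_def)
    then show ?thesis
      by (rule eventually_mono) (use interior_subset in blast)
  qed
  then have "eventually (\<lambda>k. \<forall>y\<in>X. s ^ k * y \<in> V) sequentially"
    using X(1) by (simp add: eventually_ball_finite)
  then obtain k where k: "\<forall>y\<in>X. s ^ k * y \<in> V"
    using eventually_happens trivial_limit_sequentially by blast
  \<comment> \<open>Otherwise the multiples of \<open>x\<close> would accumulate at some
    \<open>l\<close>, and multiplying them by \<open>s ^ m\<close> would give
    \<open>s ^ k * x = 0\<close>.\<close>
  have "\<exists>m. \<exists>y\<in>X. s ^ k / s ^ m * y \<notin> V"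
  proof (rule ccontr)
    assume "\<not> ?thesis"
    then have "eventually (\<lambda>m. s ^ k / s ^ m * x \<in> V) sequentially"
      using X by simp
    then obtain l G where "l \<in> V" and G: "G \<noteq> bot" "G \<le> sequentially"
      "((\<lambda>m. s ^ k / s ^ m * x) \<longlongrightarrow> l) G"
      by (rule compact_obtain_subfilter[OF V(1) sequentially_bot])
    have "((\<lambda>m. s ^ m * (s ^ k / s ^ m * x)) \<longlongrightarrow> 0 * l) G"
      by (intro tendsto_mult tendsto_mono[OF G(2)] s G)
    then have "((\<lambda>m. s ^ k * x) \<longlongrightarrow> 0) G"
      using s(1) by simp
    then show False
      using G(1) s(1) X(3) by (simp add: tendsto_const_iff)
  qed
  then obtain m where m: "\<exists>y\<in>X. s ^ k / s ^ m * y \<notin> V"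
    and least: "\<And>j. j < m \<Longrightarrow> \<not> (\<exists>y\<in>X. s ^ k / s ^ j * y \<notin> V)"
    using exists_least_iff[of "\<lambda>m. \<exists>y\<in>X. s ^ k / s ^ m * y \<notin> V"] by blast
  \<comment> \<open>By the choice of \<open>k\<close> there is no exit at \<open>m = 0\<close>, so a
    step before the first exit exists.\<close>
  have "m \<noteq> 0"
    using m k by (intro notI) simp
  then obtain j where "m = Suc j"
    using not0_implies_Suc by blast
  moreover have "s ^ k / s ^ Suc j * y = s ^ k / s ^ j * y / s" for y
    by (simp add: divide_simps)
  ultimately show thesis
    using that[of k j] m least[of j] by (metis lessI)
qed

lemma open_vimage_divide_interior:
  fixes s :: "'a::topological_field"
  shows "open {x. x / s \<in> interior V}"
proof -
  have "continuous_on UNIV (\<lambda>x. x * inverse s)"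
    by (intro continuous_intros)
  then have "open ((\<lambda>x. x * inverse s) -` interior V)"
    by (simp add: open_vimage)
  then show ?thesis
    by (simp add: vimage_def divide_inverse)
qed

lemma mat_mult_nth: "(mat c ** A) $ i $ j = c * A $ i $ j"
  for A :: "'a::comm_semiring_1 ^ 'm ^ 'n"
  by (simp add: matrix_matrix_mult_def mat_def if_distrib[of "\<lambda>x. x * _"] cong: if_cong)

text \<open>A form of the compactness of projective space: \<open>scale_into_annulus\<close> is
  applied to the set of all entries of \<open>A\<close>.\<close>

lemma matrix_projective_compact:
  obtains C :: "('a::local_field ^ 'n ^ 'n) set" where "compact C" "0 \<notin> C"
    and "\<forall>A. A \<noteq> 0 \<longrightarrow> (\<exists>c. c \<noteq> 0 \<and> mat c ** A \<in> C)"
proof -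
  obtain V :: "'a set" where V: "compact V" "0 \<in> interior V"
    using local_field_compact_nhd_0 by blast
  obtain t :: 'a where t: "t \<noteq> 0" "(\<lambda>k. t ^ k) \<longlonglongrightarrow> 0"
    using local_field_ex_power_tendsto_0 by blast
  \<comment> \<open>Using the interior makes \<open>?O\<close> open, so that \<open>?C\<close> is
    compact; and \<open>?O\<close> contains the zero matrix because 0 is interior to
    \<open>V\<close>.\<close>
  let ?O = "{A::'a^'n^'n. \<forall>i. A $ i \<in> {x. \<forall>j. x $ j \<in> {x. x / t \<in> interior V}}}"
  let ?C = "{A::'a^'n^'n. \<forall>i. A $ i \<in> {x. \<forall>j. x $ j \<in> V}} - ?O"
  have "compact ?C"
    by (intro compact_diff compact_vec_box V open_vector_box allI open_vimage_divide_interior)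
  moreover have "0 \<notin> ?C"
    using V(2) by simp
  moreover have "\<forall>A. A \<noteq> 0 \<longrightarrow> (\<exists>c. c \<noteq> 0 \<and> mat c ** A \<in> ?C)"
  proof (intro allI impI)
    fix A :: "'a ^ 'n ^ 'n" assume "A \<noteq> 0"
    let ?X = "range (\<lambda>(i, j). A $ i $ j)"
    obtain i j where Aij: "A $ i $ j \<noteq> 0"
      using \<open>A \<noteq> 0\<close> by (auto simp: vec_eq_iff)
    have "A $ i $ j \<in> ?X"
      by (rule range_eqI[of _ _ "(i, j)"]) simp
    have "finite ?X" by simp
    obtain k m where km: "\<forall>y\<in>?X. t ^ k / t ^ m * y \<in> V"
      "\<exists>y\<in>?X. t ^ k / t ^ m * y / t \<notin> V"
      by (rule scale_into_annulus[OF V t \<open>finite ?X\<close> \<open>A $ i $ j \<in> ?X\<close> Aij])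
    from km(2) obtain i' j' where "t ^ k / t ^ m * A $ i' $ j' / t \<notin> V"
      by auto
    then have "mat (t ^ k / t ^ m) ** A \<notin> ?O"
      using interior_subset[of V] by (auto simp: mat_mult_nth)
    moreover have "t ^ k / t ^ m * A $ i $ j \<in> V" for i j
      by (rule bspec[OF km(1)]) (rule range_eqI[of _ _ "(i, j)"], simp)
    ultimately show "\<exists>c. c \<noteq> 0 \<and> mat c ** A \<in> ?C"
      using t(1) by (intro exI[of _ "t ^ k / t ^ m"]) (simp add: mat_mult_nth)
  qed
  ultimately show thesis by (rule that)
qed

text \<open>Scaling by powers of \<open>t ^ n\<close> multiplies only by \<open>n\<close>-th powers.
  Finitely many representatives may not suffice: the units modulo \<open>n\<close>-th powers can be
  infinite when the characteristic divides \<open>n\<close>.\<close>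

lemma units_mod_powers_compact:
  assumes "n > 0"
  obtains D :: "'a::local_field set" where "compact D" "0 \<notin> D"
    and "\<forall>x. x \<noteq> 0 \<longrightarrow> (\<exists>y. y \<noteq> 0 \<and> y ^ n * x \<in> D)"
proof -
  obtain V :: "'a set" where V: "compact V" "0 \<in> interior V"
    using local_field_compact_nhd_0 by blast
  obtain t :: 'a where t: "t \<noteq> 0" "(\<lambda>k. t ^ k) \<longlonglongrightarrow> 0"
    using local_field_ex_power_tendsto_0 by blast
  have "(\<lambda>k. (t ^ k) ^ n) \<longlonglongrightarrow> 0 ^ n"
    by (rule tendsto_power_strong[OF t(2) tendsto_const])
  moreover have "(t ^ k) ^ n = (t ^ n) ^ k" for k
    by (metis power_mult mult.commute)
  ultimately have tn: "t ^ n \<noteq> 0" "(\<lambda>k. (t ^ n) ^ k) \<longlonglongrightarrow> 0"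
    using t(1) assms by (simp_all add: zero_power)
  let ?D = "V - {x. x / t ^ n \<in> interior V}"
  have "compact ?D"
    by (intro compact_diff V open_vimage_divide_interior)
  moreover have "0 \<notin> ?D"
    using V(2) by simp
  moreover have "\<forall>x. x \<noteq> 0 \<longrightarrow> (\<exists>y. y \<noteq> 0 \<and> y ^ n * x \<in> ?D)"
  proof (intro allI impI)
    fix x :: 'a assume x: "x \<noteq> 0"
    obtain k m where "\<forall>y\<in>{x}. (t ^ n) ^ k / (t ^ n) ^ m * y \<in> V"
      "\<exists>y\<in>{x}. (t ^ n) ^ k / (t ^ n) ^ m * y / t ^ n \<notin> V"
      by (rule scale_into_annulus[OF V tn finite.insertI[OF finite.emptyI] singletonI x])
    moreover have "(t ^ n) ^ k / (t ^ n) ^ m = (t ^ k / t ^ m) ^ n"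
      by (metis power_divide power_mult mult.commute)
    ultimately show "\<exists>y. y \<noteq> 0 \<and> y ^ n * x \<in> ?D"
      using t(1) interior_subset[of V] by (intro exI[of _ "t ^ k / t ^ m"]) auto
  qed
  ultimately show thesis by (rule that)
qed

section \<open>Rank one perturbations of the identity\<close>

definition dotp :: "'a::comm_semiring_0 ^ 'n \<Rightarrow> 'a ^ 'n \<Rightarrow> 'a" where
  "dotp v u = (\<Sum>i\<in>UNIV. v $ i * u $ i)"

definition outer :: "'a::times ^ 'm \<Rightarrow> 'a ^ 'n \<Rightarrow> 'a ^ 'n ^ 'm" where
  "outer u v = (\<chi> i j. u $ i * v $ j)"

text \<open>The determinant is \<open>1 + dotp v u\<close>; if \<open>dotp v u = 0\<close> and both
  vectors are nonzero, this is a transvection.\<close>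

definition one_plus_outer :: "'a::comm_ring_1 ^ 'n \<Rightarrow> 'a ^ 'n \<Rightarrow> 'a ^ 'n ^ 'n" where
  "one_plus_outer u v = mat 1 + outer u v"

lemma dotp_commute: "dotp v u = dotp u v"
  by (simp add: dotp_def mult.commute)

lemma dotp_add_left: "dotp (v + w) u = dotp v u + dotp w u"
  and dotp_scale_right: "dotp v (c *s u) = c * dotp v u"
  and dotp_scale_left: "dotp (c *s v) u = c * dotp v u"
  by (simp_all add: dotp_def algebra_simps sum.distrib sum_distrib_left)

lemma dotp_diff_right: "dotp v (u - w) = dotp v u - dotp v w"
  and dotp_diff_left: "dotp (v - w) u = dotp v u - dotp w u"
  for u v w :: "'a::comm_ring_1 ^ 'n"
  by (simp_all add: dotp_def algebra_simps sum_subtractf)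

lemma dotp_zero [simp]: "dotp v 0 = 0" "dotp 0 v = 0"
  by (simp_all add: dotp_def)

lemma axis_component: "axis k c $ i = (if i = k then c else 0)"
  by (simp add: axis_def)

lemma axis_0 [simp]: "axis k 0 = 0"
  by (simp add: vec_eq_iff axis_component)

lemma dotp_axis_left [simp]: "dotp (axis i c) u = c * u $ i"
  for u :: "'a::comm_ring_1 ^ 'n"
  by (simp add: dotp_def axis_def if_distrib[of "\<lambda>x. x * _"] cong: if_cong)

lemma outer_zero [simp]: "outer 0 v = 0" "outer u 0 = 0"
  for u :: "'a::comm_ring_1 ^ 'm" and v :: "'a ^ 'n"
  by (simp_all add: outer_def vec_eq_iff)

lemma one_plus_outer_zero [simp]: "one_plus_outer 0 v = mat 1" "one_plus_outer u 0 = mat 1"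
  by (simp_all add: one_plus_outer_def)

lemma outer_scale: "outer (c *s u) v = outer u (c *s v)"
  for u :: "'a::comm_ring_1 ^ 'm" and v :: "'a ^ 'n"
  by (simp add: outer_def vec_eq_iff mult.commute mult.left_commute)

lemma matrix_mult_outer: "A ** outer u v = outer (A *v u) v"
  and outer_mult_matrix: "outer u v ** B = outer u (v v* B)"
  for A :: "'a::comm_ring_1 ^ 'm ^ 'k" and B :: "'a ^ 'l ^ 'n"
  by (simp_all add: matrix_matrix_mult_def matrix_vector_mult_def vector_matrix_mult_def outer_def
      vec_eq_iff sum_distrib_left sum_distrib_right mult_ac)

lemma outer_mult_vector: "outer u v *v x = dotp v x *s u"
  and vector_mult_outer: "y v* outer u v = dotp y u *s v"
  for u :: "'a::comm_ring_1 ^ 'm" and v :: "'a ^ 'n"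
  by (simp_all add: matrix_vector_mult_def vector_matrix_mult_def outer_def dotp_def
      vec_eq_iff sum_distrib_left sum_distrib_right mult_ac)

lemma dotp_matrix_vector: "dotp v (A *v u) = dotp (v v* A) u"
  for A :: "'a::comm_ring_1 ^ 'm ^ 'n"
  unfolding dotp_def matrix_vector_mult_def vector_matrix_mult_def
  by (simp add: sum_distrib_left sum_distrib_right mult_ac) (rule sum.swap)

lemma one_plus_outer_mult_vector: "one_plus_outer u v *v x = x + dotp v x *s u"
  and vector_mult_one_plus_outer: "y v* one_plus_outer u v = y + dotp y u *s v"
  by (simp_all add: one_plus_outer_def matrix_vector_mult_add_rdistrib vector_matrix_mult_add_rdistrib
      outer_mult_vector vector_mult_outer)

lemma matrix_mult_add_rdistrib: "(A + B) ** C = A ** C + B ** C"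
  for A B :: "'a::semiring_1 ^ 'm ^ 'n"
  by (simp add: matrix_matrix_mult_def vec_eq_iff distrib_right sum.distrib)

lemma outer_add_left: "outer (u + w) v = outer u v + outer w v"
  and outer_add_right: "outer u (v + x) = outer u v + outer u x"
  for u w :: "'a::comm_ring_1 ^ 'm" and v x :: "'a ^ 'n"
  by (simp_all add: outer_def vec_eq_iff algebra_simps)

lemma one_plus_outer_mult:
  "one_plus_outer u v ** one_plus_outer p v = one_plus_outer (u + p + dotp v p *s u) v"
  "one_plus_outer u v ** one_plus_outer u b = one_plus_outer u (v + b + dotp v u *s b)"
  by (simp_all add: one_plus_outer_def matrix_add_ldistrib matrix_mult_outer
      matrix_vector_mult_add_rdistrib outer_mult_vector
      outer_add_left outer_add_right outer_scale add_ac)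

text \<open>The Sherman-Morrison formula. The last claim lets the inverse serve as a factor in the
  induction over GL.\<close>

lemma one_plus_outer_inverse:
  fixes u v :: "'a::field ^ 'n"
  assumes "1 + dotp v u \<noteq> 0"
  defines "u' \<equiv> (- 1 / (1 + dotp v u)) *s u"
  shows "one_plus_outer u v ** one_plus_outer u' v = mat 1"
    and "one_plus_outer u' v ** one_plus_outer u v = mat 1"
    and "1 + dotp v u' \<noteq> 0"
proof -
  have "u + u' + dotp v u' *s u = (1 - 1 / (1 + dotp v u) - dotp v u / (1 + dotp v u)) *s u"
    unfolding u'_def dotp_scale_right by (simp add: vec_eq_iff algebra_simps)
  also have "1 - 1 / (1 + dotp v u) - dotp v u / (1 + dotp v u) = 0"
    using assms(1) by (simp add: divide_simps)
  finally have "u + u' + dotp v u' *s u = 0" by simp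
  then show "one_plus_outer u v ** one_plus_outer u' v = mat 1"
    by (simp add: one_plus_outer_mult)
  then show "one_plus_outer u' v ** one_plus_outer u v = mat 1"
    by (simp add: matrix_left_right_inverse)
  have "1 + dotp v u' = 1 / (1 + dotp v u)"
    using assms(1) unfolding u'_def dotp_scale_right by (simp add: divide_simps)
  with assms(1) show "1 + dotp v u' \<noteq> 0" by simp
qed

lemma invertible_one_plus_outer:
  fixes u v :: "'a::field ^ 'n"
  assumes "1 + dotp v u \<noteq> 0"
  shows "invertible (one_plus_outer u v)"
  using one_plus_outer_inverse[OF assms] unfolding invertible_def by blast

section \<open>Generation of GL by invertible rank one perturbations\<close>

text \<open>For such an \<open>f\<close>, the matrix \<open>one_plus_outer (w - u) f\<close> is
  invertible and maps \<open>u\<close> to \<open>w\<close>. A coordinate functional works, or a sum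
  of two when neither coordinate is nonzero on both vectors.\<close>

lemma ex_dotp_nonzero:
  fixes u w :: "'a::field ^ 'n"
  assumes "u \<noteq> 0" "w \<noteq> 0"
  obtains f where "dotp f u = 1" "dotp f w \<noteq> 0"
proof -
  obtain i j where ij: "u $ i \<noteq> 0" "w $ j \<noteq> 0"
    using assms by (auto simp: vec_eq_iff)
  consider "w $ i \<noteq> 0" | "u $ j \<noteq> 0" | "w $ i = 0" "u $ j = 0" by blast
  then show thesis
  proof cases
    case 1 with ij that[of "axis i (1 / u $ i)"] show thesis by simp
  next
    case 2 with ij that[of "axis j (1 / u $ j)"] show thesis by simp
  next
    case 3 with ij that[of "axis i (1 / u $ i) + axis j 1"] show thesis
      by (simp add: dotp_add_left)
  qed
qed

lemma matrix_vector_mult_axis: "(A *v axis k c) $ i = A $ i $ k * c"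
  for A :: "'a::comm_ring_1 ^ 'n ^ 'm"
  by (simp add: matrix_vector_mult_def axis_def if_distrib[of "\<lambda>x. _ * x"] cong: if_cong)

lemma vector_matrix_mult_axis: "(axis k c v* A) $ i = A $ k $ i * c"
  for A :: "'a::comm_ring_1 ^ 'n ^ 'm"
  by (simp add: vector_matrix_mult_def axis_def if_distrib[of "\<lambda>x. x * _"] cong: if_cong)

text \<open>Left multiplication by a suitable factor increases the set of standard basis vectors fixed
  by the matrix.\<close>

lemma invertible_matrix_induct [consumes 1, case_names one mult]:
  fixes A :: "'a::field ^ 'n ^ 'n"
  assumes "invertible A"
    and one: "P (mat 1)"
    and mult: "\<And>u v A. 1 + dotp v u \<noteq> 0 \<Longrightarrow> invertible A \<Longrightarrow> P A \<Longrightarrow> P (one_plus_outer u v ** A)"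
  shows "P A"
  using assms(1)
proof (induction "card {k. A *v axis k 1 \<noteq> axis k 1}" arbitrary: A rule: less_induct)
  case less
  let ?K = "\<lambda>A::'a^'n^'n. {k. A *v axis k 1 \<noteq> axis k 1}"
  show ?case
  proof (cases "?K A = {}")
    case True
    then have "A *v axis j 1 = axis j 1" for j by blast
    then have "A $ i $ j = axis j 1 $ i" for i j
      by (metis matrix_vector_mult_axis mult.right_neutral)
    then have "A = mat 1"
      by (simp add: vec_eq_iff mat_def axis_def)
    then show ?thesis using one by simp
  next
    case False
    then obtain k where k: "k \<in> ?K A" by blast
    define w where "w = A *v axis k 1"
    obtain A' where A': "A' ** A = mat 1"
      using less.prems unfolding invertible_def by blast
    \<comment> \<open>If \<open>w\<close> were a combination of basis vectors fixed by
      \<open>A\<close>, then \<open>A *v w = w = A *v axis k 1\<close>, and injectivity would give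
      \<open>w = axis k 1\<close>.\<close>
    have "\<exists>j\<in>?K A. w $ j \<noteq> 0"
    proof (rule ccontr)
      assume *: "\<not> ?thesis"
      have "A $ r $ i * w $ i = (if i = r then w $ r else 0)" for r i
      proof (cases "i \<in> ?K A")
        case False
        then have "A $ r $ i = axis i 1 $ r"
          using matrix_vector_mult_axis[of A i 1 r] by simp
        then show ?thesis by (simp add: axis_def)
      qed (use * in auto)
      then have "A *v w = w"
        by (simp add: vec_eq_iff matrix_vector_mult_def)
      then have "A *v w = A *v axis k 1"
        by (simp add: w_def)
      then have "A' ** A *v w = A' ** A *v axis k 1"
        by (simp flip: matrix_vector_mul_assoc)
      then have "w = axis k 1"
        by (simp add: A')
      with k show False by (simp add: w_def)
    qed
    then obtain j where j: "j \<in> ?K A" "w $ j \<noteq> 0" by blast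
    \<comment> \<open>The factor built from \<open>f\<close> keeps the fixed basis vectors, where
      \<open>f\<close> vanishes, and carries \<open>w\<close> to \<open>axis k 1\<close> because
      \<open>dotp f w = 1\<close>. Its determinant is \<open>dotp f (axis k 1)\<close>.\<close>
    obtain f where f: "dotp f w = 1" "dotp f (axis k 1) \<noteq> 0"
      "\<And>i. i \<notin> ?K A \<Longrightarrow> dotp f (axis i 1) = 0"
    proof (cases "w $ k = 0")
      case True
      then have "j \<noteq> k" using j by auto
      show thesis
        by (rule that[of "axis j (1 / w $ j) + axis k 1"])
          (use True j k \<open>j \<noteq> k\<close> in \<open>auto simp: dotp_add_left axis_component\<close>)
    next
      case False
      show thesis
        by (rule that[of "axis k (1 / w $ k)"]) (use False k in \<open>auto simp: axis_component\<close>)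
    qed
    define u where "u = axis k 1 - w"
    have nz: "1 + dotp f u \<noteq> 0"
      using f by (simp add: u_def dotp_diff_right)
    let ?R = "one_plus_outer u f"
    have "(?R ** A) *v axis k 1 = axis k 1"
      using f(1) by (simp add: w_def[symmetric] one_plus_outer_mult_vector u_def flip: matrix_vector_mul_assoc)
    moreover have "(?R ** A) *v axis i 1 = axis i 1" if "i \<notin> ?K A" for i
    proof -
      have "A *v axis i 1 = axis i 1" using that by simp
      then show ?thesis
        using f(3)[OF that] by (simp add: one_plus_outer_mult_vector flip: matrix_vector_mul_assoc)
    qed
    ultimately have "?K (?R ** A) \<subset> ?K A"
      using k by blast
    then have "card (?K (?R ** A)) < card (?K A)"
      by (intro psubset_card_mono) simp_all
    moreover have inv: "invertible (?R ** A)"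
      by (intro invertible_mult invertible_one_plus_outer nz less.prems)
    ultimately have "P (?R ** A)"
      by (rule less.hyps)
    \<comment> \<open>\<open>A\<close> is recovered from \<open>?R ** A\<close> by the inverse of
      \<open>?R\<close>, which has the same shape.\<close>
    with mult[OF one_plus_outer_inverse(3)[OF nz] inv] show ?thesis
      by (simp only: matrix_mul_assoc one_plus_outer_inverse(2)[OF nz] matrix_mul_lid)
  qed
qed

section \<open>Homomorphisms from GL that kill transvections\<close>

lemma carrier_GL: "carrier GL = {A. invertible A}"
  and mult_GL: "A \<otimes>\<^bsub>GL\<^esub> B = A ** B"
  and one_GL: "\<one>\<^bsub>GL\<^esub> = mat 1"
  by (simp_all add: GL_def)

lemma group_GL: "group GL"
proof (rule groupI)
  fix A :: "'a^'n^'n" assume "A \<in> carrier GL"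
  then show "\<exists>B\<in>carrier GL. B \<otimes>\<^bsub>GL\<^esub> A = \<one>\<^bsub>GL\<^esub>"
    unfolding carrier_GL mult_GL one_GL invertible_def by blast
qed (simp_all add: carrier_GL mult_GL one_GL invertible_mult matrix_mul_assoc[symmetric]
      invertible_def[of "mat 1"] exI[of _ "mat 1"])

section \<open>Kernels containing a transvection\<close>

context
  fixes Q :: "('q, 'r) monoid_scheme" and h :: "'a::field ^ 'n ^ 'n \<Rightarrow> 'q"
  assumes hom: "group_hom GL Q h"
begin

interpretation group_hom GL Q h by (rule hom)

lemma hom_GL_mult: "invertible A \<Longrightarrow> invertible B \<Longrightarrow> h (A ** B) = h A \<otimes>\<^bsub>Q\<^esub> h B"
  using hom_mult[of A B] by (simp add: carrier_GL mult_GL)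

lemma hom_GL_closed: "invertible A \<Longrightarrow> h A \<in> carrier Q"
  using hom_closed by (simp add: carrier_GL)

lemma hom_GL_one: "h (mat 1) = \<one>\<^bsub>Q\<^esub>"
  using hom_one by (simp add: one_GL)

lemma hom_GL_conjugate:
  assumes "A ** A' = mat 1" "invertible X" "h X = \<one>\<^bsub>Q\<^esub>"
  shows "h (A ** X ** A') = \<one>\<^bsub>Q\<^esub>"
proof -
  have inv: "invertible A" "invertible A'"
    using assms(1) invertible_left_inverse invertible_right_inverse by blast+
  then have "h (A ** X ** A') = h A \<otimes>\<^bsub>Q\<^esub> h A'"
    using assms(2,3) by (simp add: hom_GL_mult invertible_mult hom_GL_closed)
  also have "\<dots> = h (A ** A')"
    using inv by (simp add: hom_GL_mult)
  finally show ?thesis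
    using assms(1) by (simp add: hom_GL_one)
qed

lemma conjugate_one_plus_outer:
  assumes "A ** A' = mat 1"
  shows "A ** one_plus_outer u v ** A' = one_plus_outer (A *v u) (v v* A')"
  using assms by (simp add: one_plus_outer_def matrix_add_ldistrib matrix_mult_add_rdistrib
      matrix_mult_outer outer_mult_matrix)

text \<open>Two conjugations suffice: the first carries the column \<open>a\<close> to
  \<open>u\<close>, the second fixes \<open>u\<close> and carries the resulting row
  \<open>b'\<close> to \<open>v\<close>.\<close>

lemma kills_transvections:
  fixes a b u v :: "'a ^ 'n"
  assumes ab: "h (one_plus_outer a b) = \<one>\<^bsub>Q\<^esub>" "a \<noteq> 0" "b \<noteq> 0" "dotp b a = 0"
    and uv: "dotp v u = 0"
  shows "h (one_plus_outer u v) = \<one>\<^bsub>Q\<^esub>"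
proof (cases "u = 0 \<or> v = 0")
  case True
  then show ?thesis by (auto simp: hom_GL_one)
next
  case False
  then have "u \<noteq> 0" "v \<noteq> 0" by auto
  obtain f where f: "dotp f a = 1" "dotp f u \<noteq> 0"
    using ex_dotp_nonzero[OF \<open>a \<noteq> 0\<close> \<open>u \<noteq> 0\<close>] .
  have "1 + dotp f (u - a) \<noteq> 0"
    using f by (simp add: dotp_diff_right)
  then obtain g' where g': "one_plus_outer (u - a) f ** g' = mat 1" "g' ** one_plus_outer (u - a) f = mat 1"
    using one_plus_outer_inverse by blast
  define b' where "b' = b v* g'"
  have ga: "one_plus_outer (u - a) f *v a = u"
    using f by (simp add: one_plus_outer_mult_vector)
  have *: "h (one_plus_outer u b') = \<one>\<^bsub>Q\<^esub>"
    using hom_GL_conjugate[OF g'(1) _ ab(1)] invertible_one_plus_outer[of b a] ab(4)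
    by (simp add: conjugate_one_plus_outer[OF g'(1)] ga b'_def)
  have "b' v* one_plus_outer (u - a) f = b"
    by (simp add: b'_def vector_matrix_mul_assoc g'(2))
  then have "b' \<noteq> 0"
    using ab(3) by auto
  have "dotp b' u = dotp b (g' *v (one_plus_outer (u - a) f *v a))"
    by (simp add: b'_def dotp_matrix_vector ga)
  also have "\<dots> = 0"
    by (simp add: matrix_vector_mul_assoc g' ab(4))
  finally have "dotp b' u = 0" .
  \<comment> \<open>The same construction for rows: \<open>one_plus_outer p (b' - v)\<close> takes
    \<open>v\<close> to \<open>b'\<close>, and it fixes \<open>u\<close> since both
    \<open>b'\<close> and \<open>v\<close> annihilate \<open>u\<close>.\<close>
  obtain p where p: "dotp p v = 1" "dotp p b' \<noteq> 0"
    using ex_dotp_nonzero[OF \<open>v \<noteq> 0\<close> \<open>b' \<noteq> 0\<close>] .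
  have "1 + dotp (b' - v) p \<noteq> 0"
    using p by (simp add: dotp_commute[of _ p] dotp_diff_right)
  then obtain k' where k': "one_plus_outer p (b' - v) ** k' = mat 1" "k' ** one_plus_outer p (b' - v) = mat 1"
    using one_plus_outer_inverse by blast
  have "v v* one_plus_outer p (b' - v) = b'"
    using p by (simp add: vector_mult_one_plus_outer dotp_commute[of v p])
  then have "b' v* k' = v"
    by (metis k'(1) vector_matrix_mul_assoc vector_matrix_mul_rid)
  moreover have "one_plus_outer p (b' - v) *v u = u"
    using uv \<open>dotp b' u = 0\<close> by (simp add: one_plus_outer_mult_vector dotp_diff_left)
  ultimately show ?thesis
    using hom_GL_conjugate[OF k'(1) _ *] invertible_one_plus_outer[of b' u] \<open>dotp b' u = 0\<close>
    by (simp add: conjugate_one_plus_outer[OF k'(1)])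
qed

section \<open>Homomorphisms trivial on transvections see only the determinant\<close>

context
  assumes transvections: "\<And>u v. dotp v u = 0 \<Longrightarrow> h (one_plus_outer u v) = \<one>\<^bsub>Q\<^esub>"
begin

text \<open>The right factor \<open>one_plus_outer (u' - u) v\<close> turns one matrix into the
  other and lies in the kernel.\<close>

lemma hom_one_plus_outer_cong_left:
  assumes "dotp v u = dotp v u'" "1 + dotp v u \<noteq> 0"
  shows "h (one_plus_outer u v) = h (one_plus_outer u' v)"
proof -
  have 0: "dotp v (u' - u) = 0"
    using assms by (simp add: dotp_diff_right)
  have "h (one_plus_outer u v ** one_plus_outer (u' - u) v) = h (one_plus_outer u v)"
    using 0 assms(2) by (simp add: hom_GL_mult invertible_one_plus_outer transvections hom_GL_closed)
  then show ?thesis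
    using 0 by (simp add: one_plus_outer_mult)
qed

lemma hom_one_plus_outer_cong_right:
  assumes "dotp v u = dotp v' u" "1 + dotp v u \<noteq> 0"
  shows "h (one_plus_outer u v) = h (one_plus_outer u v')"
proof -
  have 0: "dotp (v' - v) u = 0"
    using assms by (simp add: dotp_diff_left)
  have "h (one_plus_outer u (v' - v) ** one_plus_outer u v) = h (one_plus_outer u v)"
    using 0 assms(2) by (simp add: hom_GL_mult invertible_one_plus_outer transvections hom_GL_closed)
  then show ?thesis
    using 0 by (simp add: one_plus_outer_mult)
qed

text \<open>One vector is changed at a time, through a \<open>w\<close> that pairs nontrivially with
  both \<open>v\<close> and \<open>v'\<close>; so only the determinant \<open>1 + dotp v u\<close>
  matters.\<close>

lemma hom_one_plus_outer_cong:
  assumes eq: "dotp v u = dotp v' u'" and nz: "1 + dotp v u \<noteq> 0"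
  shows "h (one_plus_outer u v) = h (one_plus_outer u' v')"
proof (cases "dotp v u = 0")
  case True
  then show ?thesis using eq by (simp add: transvections)
next
  case False
  then have "v \<noteq> 0" "v' \<noteq> 0"
    using eq by auto
  then obtain p where p: "dotp p v = 1" "dotp p v' \<noteq> 0"
    by (rule ex_dotp_nonzero)
  define r where "r = dotp p v'"
  define w where "w = dotp v u *s p"
  have w: "dotp v w = dotp v u" "dotp v' w = dotp v u * r"
    using p(1) by (simp_all add: w_def r_def dotp_scale_right dotp_commute[of _ p])
  have "h (one_plus_outer u v) = h (one_plus_outer w v)"
    by (rule hom_one_plus_outer_cong_left) (simp_all add: w nz)
  also have "\<dots> = h (one_plus_outer w ((1 / r) *s v'))"
    by (rule hom_one_plus_outer_cong_right) (use p nz in \<open>simp_all add: w dotp_scale_left r_def\<close>)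
  also have "one_plus_outer w ((1 / r) *s v') = one_plus_outer ((1 / r) *s w) v'"
    by (simp add: one_plus_outer_def outer_scale)
  also have "h \<dots> = h (one_plus_outer u' v')"
    by (rule hom_one_plus_outer_cong_left) (use p nz eq in \<open>simp_all add: w dotp_scale_right r_def\<close>)
  finally show ?thesis .
qed

text \<open>On the right stands the diagonal matrix with \<open>x\<close> at place \<open>k\<close>
  and 1 elsewhere. The induction multiplies the determinants of the factors, so \<open>x\<close>
  arises as the determinant of \<open>A\<close>.\<close>

lemma hom_GL_eq_hom_one_plus_outer_axis:
  assumes "invertible A"
  shows "\<exists>x. x \<noteq> 0 \<and> h A = h (one_plus_outer (axis k (x - 1)) (axis k 1))"
  using assms
proof (induction rule: invertible_matrix_induct)
  case one
  show ?case by (rule exI[of _ 1]) simp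
next
  case (mult u v A)
  then obtain x where x: "x \<noteq> 0" "h A = h (one_plus_outer (axis k (x - 1)) (axis k 1))"
    by blast
  let ?d = "\<lambda>x. one_plus_outer (axis k (x - 1)) (axis k 1)"
  have inv: "invertible (?d y)" if "y \<noteq> 0" for y :: 'a
    by (rule invertible_one_plus_outer) (use that in simp)
  let ?y = "1 + dotp v u"
  have "h (one_plus_outer u v) = h (?d ?y)"
    by (rule hom_one_plus_outer_cong) (use mult in simp_all)
  then have "h (one_plus_outer u v ** A) = h (?d ?y ** ?d x)"
    using mult x inv by (simp add: hom_GL_mult invertible_one_plus_outer)
  also have "?d ?y ** ?d x = ?d (?y * x)"
    unfolding one_plus_outer_mult
    by (rule arg_cong[of _ _ "\<lambda>u. one_plus_outer u _"]) (simp add: vec_eq_iff axis_component algebra_simps)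
  finally show ?case
    using mult x by (intro exI[of _ "?y * x"]) simp
qed

text \<open>\<open>mat y\<close> has determinant \<open>y ^ CARD('n)\<close>, so with
  \<open>mat y\<close> the diagonal matrix carrying that single entry is killed too. To see this,
  \<open>mat y\<close> is built up one diagonal entry at a time.\<close>

lemma hom_one_plus_outer_axis_power:
  assumes scalar: "h (mat y) = \<one>\<^bsub>Q\<^esub>" and "x \<noteq> 0" "y \<noteq> 0"
  shows "h (one_plus_outer (axis k (y ^ CARD('n) * x - 1)) (axis k 1)) =
    h (one_plus_outer (axis k (x - 1)) (axis k 1))"
proof -
  let ?d = "\<lambda>x. one_plus_outer (axis k (x - 1)) (axis k 1)"
  let ?D = "\<lambda>S. \<chi> i j. if i = j then if i \<in> S then y else 1 else 0"
  have inv: "invertible (?d z)" if "z \<noteq> 0" for z :: 'a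
    by (rule invertible_one_plus_outer) (use that in simp)
  have d_mult: "?d z ** ?d z' = ?d (z * z')" for z z' :: 'a
    unfolding one_plus_outer_mult
    by (rule arg_cong[of _ _ "\<lambda>u. one_plus_outer u _"]) (simp add: vec_eq_iff axis_component algebra_simps)
  have D: "invertible (?D S) \<and> h (?D S) = h (?d (y ^ card S))" for S :: "'n set"
    using finite[of S]
  proof (induction S rule: finite_induct)
    case empty
    have "?D {} = mat 1"
      by (simp add: mat_def cong: if_cong)
    show ?case
      unfolding \<open>?D {} = mat 1\<close> using inv[of 1] by simp
  next
    case (insert i S)
    let ?R = "one_plus_outer (axis i (y - 1)) (axis i 1)"
    \<comment> \<open>Row \<open>i\<close> of \<open>?D S\<close> is still that of the identity, so
      multiplying by \<open>?R\<close> changes only the diagonal entry at \<open>i\<close>, from 1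
      to \<open>y\<close>.\<close>
    have "axis i 1 v* ?D S = axis i 1"
      using insert.hyps by (simp add: vec_eq_iff axis_component vector_matrix_mult_axis)
    then have "?R ** ?D S = ?D S + outer (axis i (y - 1)) (axis i 1)"
      by (simp add: one_plus_outer_def matrix_mult_add_rdistrib outer_mult_matrix)
    then have "?D (insert i S) = ?R ** ?D S"
      using insert.hyps by (auto simp: vec_eq_iff axis_component outer_def)
    moreover have "invertible ?R"
      by (rule invertible_one_plus_outer) (simp add: \<open>y \<noteq> 0\<close>)
    moreover have "h ?R = h (?d y)"
      by (rule hom_one_plus_outer_cong) (simp_all add: \<open>y \<noteq> 0\<close>)
    moreover have "h (?d y) \<otimes>\<^bsub>Q\<^esub> h (?d (y ^ card S)) = h (?d (y ^ card (insert i S)))"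
      using insert.hyps \<open>y \<noteq> 0\<close> by (simp add: inv d_mult flip: hom_GL_mult)
    ultimately show ?case
      using insert.IH by (simp add: hom_GL_mult invertible_mult)
  qed
  have "?D (UNIV :: 'n set) = mat y"
    by (simp add: mat_def cong: if_cong)
  then have "h (?d (y ^ CARD('n))) = \<one>\<^bsub>Q\<^esub>"
    using D[of UNIV] scalar by (metis (no_types))
  then have "h (?d (y ^ CARD('n)) ** ?d x) = h (?d x)"
    using assms(2,3) by (simp add: hom_GL_mult inv hom_GL_closed)
  then show ?thesis
    by (simp add: d_mult)
qed

end

end

section \<open>Quotients of topological groups\<close>

lemma topological_group_limitin_mult:
  assumes "topological_group G T" "limitin T f a F" "limitin T g b F"
  shows "limitin T (\<lambda>x. f x \<otimes>\<^bsub>G\<^esub> g x) (a \<otimes>\<^bsub>G\<^esub> b) F"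
proof -
  have lim: "limitin (prod_topology T T) (\<lambda>x. (f x, g x)) (a, b) F"
    using assms(2,3) by (simp add: limitin_pairwise o_def)
  have "continuous_map (prod_topology T T) T (\<lambda>(x, y). x \<otimes>\<^bsub>G\<^esub> y)"
    using assms(1) by (simp add: topological_group_def)
  from continuous_map_limit[OF this lim] show ?thesis
    by (simp add: o_def)
qed

lemma topological_group_limitin_inv:
  assumes "topological_group G T" "limitin T f a F"
  shows "limitin T (\<lambda>x. inv\<^bsub>G\<^esub> f x) (inv\<^bsub>G\<^esub> a) F"
  using continuous_map_limit[of T T "\<lambda>x. inv\<^bsub>G\<^esub> x" f a F] assms
  by (simp add: topological_group_def o_def)

text \<open>Reduces continuity of group operations to limit rules along arbitrary filters.\<close>

lemma continuous_map_if_limitin: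
  assumes "\<And>x F. limitin X (\<lambda>y. y) x F \<Longrightarrow> limitin Y f (f x) F"
  shows "continuous_map X Y f"
  unfolding continuous_map_atin
proof
  fix x assume "x \<in> topspace X"
  then have "limitin X (\<lambda>y. y) x (atin X x)"
    using continuous_map_id[of X] unfolding continuous_map_atin by (simp add: id_def)
  then show "limitin Y f (f x) (atin X x)"
    by (rule assms)
qed

section \<open>Quotients by normal subgroups, and the center\<close>

text \<open>The saturation of \<open>U\<close> is the union of its translates by elements of
  \<open>N\<close>, each of which is open.\<close>

lemma open_map_quotient_group:
  fixes G (structure)
  assumes T: "topological_group G T" and N: "N \<lhd> G"
  shows "open_map T (quotient_group_topology G T N) (\<lambda>x. N #>\<^bsub>G\<^esub> x)"
  unfolding open_map_def
proof (intro allI impI)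
  interpret normal N G by fact
  fix U assume U: "openin T U"
  have carr: "topspace T = carrier G"
    using T by (simp add: topological_group_def)
  have UG: "U \<subseteq> carrier G"
    using openin_subset[OF U] carr by simp
  have "openin T {x \<in> topspace T. inv n \<otimes> x \<in> U}" if "n \<in> N" for n
  proof (rule openin_continuous_map_preimage[OF continuous_map_if_limitin U])
    fix x F assume x: "limitin T (\<lambda>y. y) x F"
    have "limitin T (\<lambda>y. inv n) (inv n) F"
      using carr that by simp
    from topological_group_limitin_mult[OF T this x]
    show "limitin T (\<lambda>x. inv n \<otimes> x) (inv n \<otimes> x) F" .
  qed
  then have "openin T (\<Union>n\<in>N. {x \<in> topspace T. inv n \<otimes> x \<in> U})"
    by blast
  also have "(\<Union>n\<in>N. {x \<in> topspace T. inv n \<otimes> x \<in> U}) = {x \<in> topspace T. N #> x \<in> (\<lambda>x. N #> x) ` U}"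
  proof (intro Set.set_eqI iffI)
    fix x assume "x \<in> (\<Union>n\<in>N. {x \<in> topspace T. inv n \<otimes> x \<in> U})"
    then obtain n where n: "n \<in> N" "x \<in> carrier G" "inv n \<otimes> x \<in> U"
      using carr by auto
    then have "N #> x = N #> (inv n \<otimes> x)"
      by (metis coset_mult_assoc coset_join2 m_inv_closed mem_carrier subset subgroup_axioms inv_closed)
    with n carr show "x \<in> {x \<in> topspace T. N #> x \<in> (\<lambda>x. N #> x) ` U}"
      by auto
  next
    fix x assume "x \<in> {x \<in> topspace T. N #> x \<in> (\<lambda>x. N #> x) ` U}"
    then obtain u where u: "u \<in> U" "x \<in> carrier G" "N #> x = N #> u"
      using carr by auto
    then have "x \<in> N #> u"
      using rcos_self[OF u(2) subgroup_axioms] by simp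
    then obtain n where n: "n \<in> N" "x = n \<otimes> u"
      unfolding r_coset_def by blast
    then have "inv n \<otimes> x = u"
      using u UG by (simp add: inv_solve_left' subsetD)
    with n u carr show "x \<in> (\<Union>n\<in>N. {x \<in> topspace T. inv n \<otimes> x \<in> U})"
      by (intro UN_I[OF n(1)]) simp
  qed
  finally show "openin (quotient_group_topology G T N) ((\<lambda>x. N #> x) ` U)"
    using UG carr by (simp add: quotient_group_topology_def openin_quotient_topology image_mono)
qed

lemma continuous_map_quotient_group:
  "continuous_map T (quotient_group_topology G T N) (\<lambda>x. N #>\<^bsub>G\<^esub> x)"
  unfolding quotient_group_topology_def
  by (rule quotient_imp_continuous_map[OF quotient_map_quotient_topology])

text \<open>Openness of the projection gives continuity of the product, closedness of
  \<open>N\<close> gives the Hausdorff property.\<close>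

lemma topological_group_quotient:
  fixes G (structure)
  assumes T: "topological_group G T" and N: "N \<lhd> G" "closedin T N"
  shows "topological_group (G Mod N) (quotient_group_topology G T N)"
proof -
  interpret normal N G by fact
  interpret Q: group "G Mod N" by (rule factorgroup_is_group)
  let ?Q = "quotient_group_topology G T N"
  let ?q = "\<lambda>x. N #> x"
  have carr: "topspace T = carrier G"
    using T by (simp add: topological_group_def)
  have carrQ: "carrier (G Mod N) = ?q ` carrier G"
    by (rule carrier_FactGroup)
  have top: "topspace ?Q = carrier (G Mod N)"
    by (simp add: quotient_group_topology_def carrQ carr)
  have q_mult: "?q x \<otimes>\<^bsub>G Mod N\<^esub> ?q y = ?q (x \<otimes> y)" if "x \<in> carrier G" "y \<in> carrier G" for x y
    using that by (simp add: rcos_sum)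
  interpret q: group_hom G "G Mod N" ?q
    by (intro group_hom.intro group_hom_axioms.intro r_coset_hom_Mod is_group Q.is_group)
  have open_q: "openin ?Q (?q ` U)" if "openin T U" for U
    using open_map_quotient_group[OF T N(1)] that unfolding open_map_def by blast
  have cont_q: "continuous_map T ?Q ?q"
    by (rule continuous_map_quotient_group)
  have cont_mult: "continuous_map (prod_topology T T) T (\<lambda>(x, y). x \<otimes> y)"
    and cont_inv: "continuous_map T T (\<lambda>x. inv x)"
    using T by (simp_all add: topological_group_def)
  \<comment> \<open>An open box around representatives projects to an open box of cosets, in which
    every pair has representatives with \<open>f\<close> in \<open>W\<close>. This serves both
    separation and multiplication.\<close>
  have box: "\<exists>U V. openin ?Q U \<and> openin ?Q V \<and> ?q x \<in> U \<and> ?q y \<in> V \<and>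
      (\<forall>X\<in>U. \<forall>Y\<in>V. \<exists>x y. X = ?q x \<and> Y = ?q y \<and> x \<in> carrier G \<and> y \<in> carrier G \<and> f (x, y) \<in> W)"
    if f: "continuous_map (prod_topology T T) Z f" and W: "openin Z W"
      and xy: "x \<in> carrier G" "y \<in> carrier G" "f (x, y) \<in> W" for f :: "'a \<times> 'a \<Rightarrow> 'c" and Z W x y
  proof -
    have "openin (prod_topology T T) {p \<in> topspace (prod_topology T T). f p \<in> W}"
      using f W by (rule openin_continuous_map_preimage)
    moreover have "(x, y) \<in> {p \<in> topspace (prod_topology T T). f p \<in> W}"
      using xy carr by simp
    ultimately obtain U V where UV: "openin T U" "openin T V" "x \<in> U" "y \<in> V"
      "U \<times> V \<subseteq> {p \<in> topspace (prod_topology T T). f p \<in> W}"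
      unfolding openin_prod_topology_alt by meson
    show ?thesis
    proof (rule exI[of _ "?q ` U"], rule exI[of _ "?q ` V"], intro conjI ballI)
      fix X Y assume "X \<in> ?q ` U" "Y \<in> ?q ` V"
      then obtain x y where "X = ?q x" "Y = ?q y" "(x, y) \<in> U \<times> V"
        by blast
      with UV(5) carr show "\<exists>x y. X = ?q x \<and> Y = ?q y \<and> x \<in> carrier G \<and> y \<in> carrier G \<and> f (x, y) \<in> W"
        by (intro exI[of _ x] exI[of _ y]) auto
    qed (use UV open_q in auto)
  qed
  have "Hausdorff_space ?Q"
    unfolding Hausdorff_space_def
  proof (intro allI impI, elim conjE)
    fix X Y assume XY: "X \<in> topspace ?Q" "Y \<in> topspace ?Q" "X \<noteq> Y"
    then obtain x y where xy: "x \<in> carrier G" "y \<in> carrier G" "X = ?q x" "Y = ?q y"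
      unfolding top carrQ by blast
    have diff: "?q x = ?q y" if "x \<in> carrier G" "y \<in> carrier G" "x \<otimes> inv y \<in> N" for x y
    proof -
      have "?q (x \<otimes> inv y \<otimes> y) = ?q (x \<otimes> inv y) \<otimes>\<^bsub>G Mod N\<^esub> ?q y"
        using that by (simp add: q_mult)
      also have "?q (x \<otimes> inv y) = \<one>\<^bsub>G Mod N\<^esub>"
        using that by (simp add: coset_join2 subgroup_axioms)
      also have "\<one>\<^bsub>G Mod N\<^esub> \<otimes>\<^bsub>G Mod N\<^esub> ?q y = ?q y"
        by (rule Q.l_one) (use that in \<open>simp add: carrQ\<close>)
      finally show ?thesis
        using that by (simp add: m_assoc)
    qed
    have cont: "continuous_map (prod_topology T T) T (\<lambda>(x, y). x \<otimes> inv y)"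
    proof (rule continuous_map_if_limitin)
      fix p F assume "limitin (prod_topology T T) (\<lambda>y. y) p F"
      then have "limitin T fst (fst p) F" "limitin T snd (snd p) F"
        by (simp_all add: limitin_pairwise o_def)
      then show "limitin T (\<lambda>(x, y). x \<otimes> inv y) (case p of (x, y) \<Rightarrow> x \<otimes> inv y) F"
        using topological_group_limitin_mult[OF T _ topological_group_limitin_inv[OF T]]
        by (simp add: case_prod_unfold)
    qed
    \<comment> \<open>The cosets of \<open>x\<close> and \<open>y\<close> differ exactly when
      \<open>x \<otimes> inv y\<close> lies outside \<open>N\<close>. The box for this open
      condition separates them: a common coset would violate it.\<close>
    have op: "openin T (topspace T - N)"
      using N(2) by (simp add: closedin_def)
    have mem: "(\<lambda>(x, y). x \<otimes> inv y) (x, y) \<in> topspace T - N"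
      using diff[OF xy(1,2)] XY(3) xy carr by auto
    obtain U V where UV: "openin ?Q U" "openin ?Q V" "?q x \<in> U" "?q y \<in> V"
      and *: "\<forall>X\<in>U. \<forall>Y\<in>V. \<exists>x y. X = ?q x \<and> Y = ?q y \<and> x \<in> carrier G \<and> y \<in> carrier G \<and>
        (\<lambda>(x, y). x \<otimes> inv y) (x, y) \<in> topspace T - N"
      using box[OF cont op xy(1,2) mem] by (elim exE conjE) (rule that)
    have "False" if Z: "Z \<in> U" "Z \<in> V" for Z
    proof -
      obtain x y where z: "Z = ?q x" "Z = ?q y" "x \<in> carrier G" "y \<in> carrier G" "x \<otimes> inv y \<notin> N"
        using bspec[OF bspec[OF * Z(1)] Z(2)] by (elim exE conjE) (rule that, assumption+, simp)
      then have "x \<in> N #> y"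
        using rcos_self[OF z(3) subgroup_axioms] by simp
      then obtain n where "n \<in> N" "x = n \<otimes> y"
        unfolding r_coset_def by blast
      with z show False
        by (simp add: m_assoc)
    qed
    then have "disjnt U V"
      by (auto simp: disjnt_def)
    with UV xy show "\<exists>U V. openin ?Q U \<and> openin ?Q V \<and> X \<in> U \<and> Y \<in> V \<and> disjnt U V"
      by blast
  qed
  moreover have "continuous_map (prod_topology ?Q ?Q) ?Q (\<lambda>(X, Y). X \<otimes>\<^bsub>G Mod N\<^esub> Y)"
    unfolding continuous_map
  proof (intro conjI allI impI)
    show "(\<lambda>(X, Y). X \<otimes>\<^bsub>G Mod N\<^esub> Y) ` topspace (prod_topology ?Q ?Q) \<subseteq> topspace ?Q"
      using top Q.m_closed by auto
  next
    fix W assume W: "openin ?Q W"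
    show "openin (prod_topology ?Q ?Q)
        {p \<in> topspace (prod_topology ?Q ?Q). (case p of (X, Y) \<Rightarrow> X \<otimes>\<^bsub>G Mod N\<^esub> Y) \<in> W}"
      unfolding openin_prod_topology_alt
    proof (intro allI impI)
      fix X Y assume "(X, Y) \<in> {p \<in> topspace (prod_topology ?Q ?Q). (case p of (X, Y) \<Rightarrow> X \<otimes>\<^bsub>G Mod N\<^esub> Y) \<in> W}"
      then have XY: "X \<in> carrier (G Mod N)" "Y \<in> carrier (G Mod N)" "X \<otimes>\<^bsub>G Mod N\<^esub> Y \<in> W"
        using top by auto
      then obtain x y where xy: "x \<in> carrier G" "y \<in> carrier G" "X = ?q x" "Y = ?q y"
        unfolding carrQ by blast
      have mem: "(?q \<circ> (\<lambda>(x, y). x \<otimes> y)) (x, y) \<in> W"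
        using XY xy q_mult by simp
      obtain U V where UV: "openin ?Q U" "openin ?Q V" "?q x \<in> U" "?q y \<in> V"
        and *: "\<forall>X\<in>U. \<forall>Y\<in>V. \<exists>x y. X = ?q x \<and> Y = ?q y \<and> x \<in> carrier G \<and> y \<in> carrier G \<and>
          (?q \<circ> (\<lambda>(x, y). x \<otimes> y)) (x, y) \<in> W"
        using box[OF continuous_map_compose[OF cont_mult cont_q] W xy(1,2) mem]
        by (elim exE conjE) (rule that)
      have "U \<times> V \<subseteq> {p \<in> topspace (prod_topology ?Q ?Q). (case p of (X, Y) \<Rightarrow> X \<otimes>\<^bsub>G Mod N\<^esub> Y) \<in> W}"
      proof
        fix p assume "p \<in> U \<times> V"
        then obtain X Y where XY: "X \<in> U" "Y \<in> V" and p: "p = (X, Y)"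
          by blast
        obtain x y where "X = ?q x" "Y = ?q y" "x \<in> carrier G" "y \<in> carrier G" "?q (x \<otimes> y) \<in> W"
          using bspec[OF bspec[OF * XY(1)] XY(2)] by (elim exE conjE) (rule that, assumption+, simp)
        then have "X \<otimes>\<^bsub>G Mod N\<^esub> Y \<in> W"
          using q_mult by simp
        moreover have "X \<in> topspace ?Q" "Y \<in> topspace ?Q"
          using XY UV(1,2) openin_subset by blast+
        ultimately show "p \<in> {p \<in> topspace (prod_topology ?Q ?Q). (case p of (X, Y) \<Rightarrow> X \<otimes>\<^bsub>G Mod N\<^esub> Y) \<in> W}"
          by (simp add: p)
      qed
      with UV xy show "\<exists>U V. openin ?Q U \<and> openin ?Q V \<and> X \<in> U \<and> Y \<in> V \<and>
          U \<times> V \<subseteq> {p \<in> topspace (prod_topology ?Q ?Q). (case p of (X, Y) \<Rightarrow> X \<otimes>\<^bsub>G Mod N\<^esub> Y) \<in> W}"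
        by blast
    qed
  qed
  moreover have "continuous_map ?Q ?Q (\<lambda>X. inv\<^bsub>G Mod N\<^esub> X)"
  proof -
    \<comment> \<open>Inversion has one argument, so the universal property of the quotient map
      suffices.\<close>
    have "continuous_map T ?Q (?q \<circ> (\<lambda>x. inv x))"
      by (rule continuous_map_compose[OF cont_inv cont_q])
    then have "continuous_map T ?Q ((\<lambda>X. inv\<^bsub>G Mod N\<^esub> X) \<circ> ?q)"
      by (rule continuous_map_eq) (simp add: carr q.hom_inv)
    then show ?thesis
      unfolding quotient_group_topology_def
      by (rule continuous_compose_quotient_map[OF quotient_map_quotient_topology])
  qed
  ultimately show ?thesis
    unfolding topological_group_def using Q.is_group top by blast
qed

lemma (in group) group_center_normal: "group_center G \<lhd> G"
proof (rule normal_invI)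
  show "subgroup (group_center G) G"
  proof (rule subgroupI)
    show "group_center G \<noteq> {}"
      unfolding group_center_def by force
  next
    fix a assume a: "a \<in> group_center G"
    have "inv a \<otimes> g = g \<otimes> inv a" if g: "g \<in> carrier G" for g
    proof -
      have ag: "a \<in> carrier G" "a \<otimes> g = g \<otimes> a"
        using a g by (simp_all add: group_center_def)
      have "inv a \<otimes> g = inv a \<otimes> (g \<otimes> a) \<otimes> inv a"
        using ag(1) g by (simp add: m_assoc)
      also have "\<dots> = g \<otimes> inv a"
        unfolding ag(2)[symmetric] using ag(1) g by (simp add: m_assoc[symmetric])
      finally show ?thesis .
    qed
    with a show "inv a \<in> group_center G"
      by (simp add: group_center_def)
  next
    fix a b assume ab: "a \<in> group_center G" "b \<in> group_center G"
    have "a \<otimes> b \<otimes> g = g \<otimes> (a \<otimes> b)" if g: "g \<in> carrier G" for g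
    proof -
      have abg: "a \<in> carrier G" "b \<in> carrier G" "a \<otimes> g = g \<otimes> a" "b \<otimes> g = g \<otimes> b"
        using ab g by (simp_all add: group_center_def)
      have "a \<otimes> b \<otimes> g = a \<otimes> (g \<otimes> b)"
        using abg g by (simp add: m_assoc)
      also have "\<dots> = g \<otimes> (a \<otimes> b)"
        using abg g by (simp add: m_assoc[symmetric])
      finally show ?thesis .
    qed
    with ab show "a \<otimes> b \<in> group_center G"
      unfolding group_center_def by blast
  qed (auto simp only: group_center_def)
next
  fix x z assume x: "x \<in> carrier G" and z: "z \<in> group_center G"
  then have "z \<in> carrier G" "x \<otimes> z = z \<otimes> x"
    unfolding group_center_def by simp_all
  then have "x \<otimes> z \<otimes> inv x = z"
    using x by (simp add: m_assoc)
  with z show "x \<otimes> z \<otimes> inv x \<in> group_center G" by simp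
qed

text \<open>The center is an intersection of equalizers of left and right translations. This makes
  PGL Hausdorff.\<close>

lemma closedin_group_center:
  fixes G (structure)
  assumes T: "topological_group G T"
  shows "closedin T (group_center G)"
proof -
  interpret group G using T by (simp add: topological_group_def)
  have carr: "topspace T = carrier G"
    using T by (simp add: topological_group_def)
  have "closedin T {z \<in> topspace T. z \<otimes> g = g \<otimes> z}" if g: "g \<in> carrier G" for g
  proof (rule closedin_continuous_maps_eq)
    show "Hausdorff_space T" using T by (simp add: topological_group_def)
    have "limitin T (\<lambda>y. g) g F" for F :: "'a filter"
      using g carr by simp
    then show "continuous_map T T (\<lambda>z. z \<otimes> g)" "continuous_map T T (\<lambda>z. g \<otimes> z)"
      by (auto intro!: continuous_map_if_limitin topological_group_limitin_mult[OF T])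
  qed
  then have "closedin T (\<Inter>g\<in>carrier G. {z \<in> topspace T. z \<otimes> g = g \<otimes> z})"
    by (intro closedin_Inter) auto
  also have "(\<Inter>g\<in>carrier G. {z \<in> topspace T. z \<otimes> g = g \<otimes> z}) = group_center G"
    using carr by (auto simp: group_center_def)
  finally show ?thesis .
qed

section \<open>The topological group GL\<close>

lemma tendsto_matrix_mult:
  fixes A B :: "'a::{topological_comm_monoid_add,topological_semigroup_mult,semiring_1} ^ 'n ^ 'n"
  assumes "(f \<longlongrightarrow> A) F" "(g \<longlongrightarrow> B) F"
  shows "((\<lambda>x. f x ** g x) \<longlongrightarrow> A ** B) F"
  unfolding matrix_matrix_mult_def
  by (intro tendsto_vec_lambda tendsto_sum tendsto_mult tendsto_vec_nth assms)

lemma tendsto_matrix_vector_mult: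
  fixes A :: "'a::{topological_comm_monoid_add,topological_semigroup_mult,semiring_1} ^ 'n ^ 'm"
  assumes "(f \<longlongrightarrow> A) F"
  shows "((\<lambda>x. f x *v u) \<longlongrightarrow> A *v u) F"
  unfolding matrix_vector_mult_def
  by (intro tendsto_vec_lambda tendsto_sum tendsto_mult tendsto_vec_nth assms tendsto_const)

lemma tendsto_vector_matrix_mult:
  fixes A :: "'a::{topological_comm_monoid_add,topological_semigroup_mult,semiring_1} ^ 'n ^ 'm"
  assumes "(f \<longlongrightarrow> A) F"
  shows "((\<lambda>x. v v* f x) \<longlongrightarrow> v v* A) F"
  unfolding vector_matrix_mult_def
  by (intro tendsto_vec_lambda tendsto_sum tendsto_mult tendsto_vec_nth assms tendsto_const)

lemma tendsto_one_plus_outer: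
  fixes u v :: "'a::topological_field ^ 'n"
  assumes "(f \<longlongrightarrow> u) F" "(g \<longlongrightarrow> v) F"
  shows "((\<lambda>x. one_plus_outer (f x) (g x)) \<longlongrightarrow> one_plus_outer u v) F"
proof (intro vec_tendstoI)
  fix i j
  have "((\<lambda>x. mat 1 $ i $ j + f x $ i * g x $ j) \<longlongrightarrow> mat 1 $ i $ j + u $ i * v $ j) F"
    by (intro tendsto_add tendsto_mult tendsto_vec_nth assms tendsto_const)
  then show "((\<lambda>x. one_plus_outer (f x) (g x) $ i $ j) \<longlongrightarrow> one_plus_outer u v $ i $ j) F"
    by (simp add: one_plus_outer_def outer_def)
qed

lemma tendsto_det:
  fixes A :: "'a::topological_field ^ 'n ^ 'n"
  assumes "(f \<longlongrightarrow> A) F"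
  shows "((\<lambda>x. det (f x)) \<longlongrightarrow> det A) F"
  unfolding det_def
  by (intro tendsto_sum tendsto_mult tendsto_prod' tendsto_vec_nth assms tendsto_const)

text \<open>Cramer's rule writes each entry of the inverse as a quotient of two determinants, which
  depends continuously on the matrix.\<close>

lemma tendsto_inverse_matrix:
  fixes A :: "'a::topological_field ^ 'n ^ 'n"
  assumes f: "(f \<longlongrightarrow> A) F" and A: "A ** A' = mat 1"
    and inv: "eventually (\<lambda>x. f x ** f' x = mat 1) F"
  shows "(f' \<longlongrightarrow> A') F"
proof (intro vec_tendstoI)
  fix i k
  \<comment> \<open>For invertible \<open>M\<close>, this is coordinate \<open>i\<close> of the
    solution \<open>x\<close> of \<open>M *v x = axis k 1\<close>.\<close>
  define c where "c M = det (\<chi> r s. if s = i then axis k 1 $ r else M $ r $ s) * inverse (det M)"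
    for M :: "'a ^ 'n ^ 'n"
  have c: "M' $ i $ k = c M" if "M ** M' = mat 1" for M M' :: "'a ^ 'n ^ 'n"
  proof -
    have "M *v (M' *v axis k 1) = axis k 1"
      using that by (simp add: matrix_vector_mul_assoc)
    moreover have "det M \<noteq> 0"
      using that invertible_right_inverse invertible_det_nz by blast
    ultimately have "M' *v axis k 1 = (\<chi> i. det (\<chi> r s. if s = i then axis k 1 $ r else M $ r $ s) / det M)"
      using cramer by blast
    then have "(M' *v axis k 1) $ i = c M"
      by (simp add: c_def divide_inverse)
    then show ?thesis
      by (simp add: matrix_vector_mult_axis)
  qed
  have "det A \<noteq> 0"
    using A invertible_right_inverse invertible_det_nz by blast
  moreover have "((\<lambda>x. \<chi> r s. if s = i then axis k 1 $ r else f x $ r $ s) \<longlongrightarrow>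
      (\<chi> r s. if s = i then axis k 1 $ r else A $ r $ s)) F"
  proof (intro tendsto_vec_lambda)
    fix r s
    show "((\<lambda>x. if s = i then axis k 1 $ r else f x $ r $ s) \<longlongrightarrow>
        (if s = i then axis k 1 $ r else A $ r $ s)) F"
      by (cases "s = i") (simp_all add: tendsto_vec_nth f)
  qed
  ultimately have "((\<lambda>x. c (f x)) \<longlongrightarrow> c A) F"
    unfolding c_def by (intro tendsto_mult tendsto_det tendsto_inverse_topological_field f)
  moreover have "eventually (\<lambda>x. c (f x) = f' x $ i $ k) F"
    using inv by eventually_elim (simp add: c)
  ultimately have "((\<lambda>x. f' x $ i $ k) \<longlongrightarrow> c A) F"
    by (rule Lim_transform_eventually)
  then show "((\<lambda>x. f' x $ i $ k) \<longlongrightarrow> A' $ i $ k) F"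
    by (simp add: c[OF A])
qed

lemma limitin_GL_topology:
  "limitin GL_topology f A F \<longleftrightarrow> invertible A \<and> eventually (\<lambda>x. invertible (f x)) F \<and> (f \<longlongrightarrow> A) F"
  by (simp add: GL_topology_def limitin_subtopology carrier_GL)

lemma Hausdorff_space_matrix: "Hausdorff_space (euclidean :: ('a::t2_space ^ 'n ^ 'm) topology)"
  unfolding Hausdorff_space_def
proof (intro allI impI, elim conjE)
  fix A B :: "'a ^ 'n ^ 'm" assume "A \<noteq> B"
  then obtain i j where "A $ i $ j \<noteq> B $ i $ j"
    by (auto simp: vec_eq_iff)
  from hausdorff[OF this] obtain U V
    where UV: "open U" "open V" "A $ i $ j \<in> U" "B $ i $ j \<in> V" "U \<inter> V = {}"
    by blast
  have "open {A :: 'a ^ 'n ^ 'm. A $ i $ j \<in> W}" if "open W" for W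
    using open_vimage_vec_nth[OF open_vimage_vec_nth[OF that, of j], of i] by (simp add: vimage_def)
  with UV(1,2) have "open {A :: 'a ^ 'n ^ 'm. A $ i $ j \<in> U}" "open {A :: 'a ^ 'n ^ 'm. A $ i $ j \<in> V}"
    by blast+
  moreover have "disjnt {A :: 'a ^ 'n ^ 'm. A $ i $ j \<in> U} {A. A $ i $ j \<in> V}"
    using UV(5) by (auto simp: disjnt_def)
  moreover have "A \<in> {A. A $ i $ j \<in> U}" "B \<in> {A. A $ i $ j \<in> V}"
    using UV(3,4) by simp_all
  ultimately show "\<exists>U V. openin euclidean U \<and> openin euclidean V \<and> A \<in> U \<and> B \<in> V \<and> disjnt U V"
    unfolding open_openin[symmetric] by blast
qed

lemma topological_group_GL:
  "topological_group (GL :: ('a::{topological_field,t2_space} ^ 'n ^ 'n) monoid) GL_topology"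
proof -
  interpret group "GL :: ('a ^ 'n ^ 'n) monoid" by (rule group_GL)
  have "Hausdorff_space (GL_topology :: ('a ^ 'n ^ 'n) topology)"
    unfolding GL_topology_def by (rule Hausdorff_space_subtopology[OF Hausdorff_space_matrix])
  moreover have "continuous_map (prod_topology GL_topology GL_topology) GL_topology
      (\<lambda>(x, y :: 'a ^ 'n ^ 'n). x \<otimes>\<^bsub>GL\<^esub> y)"
  proof (rule continuous_map_if_limitin)
    fix p :: "('a ^ 'n ^ 'n) \<times> ('a ^ 'n ^ 'n)" and F
    assume "limitin (prod_topology GL_topology GL_topology) (\<lambda>y. y) p F"
    then have *: "limitin GL_topology fst (fst p) F" "limitin GL_topology snd (snd p) F"
      by (simp_all add: limitin_pairwise o_def)
    then have "eventually (\<lambda>x. invertible (fst x ** snd x)) F"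
      unfolding limitin_GL_topology by (auto elim: eventually_elim2 intro: invertible_mult)
    with * show "limitin GL_topology (\<lambda>(x, y). x \<otimes>\<^bsub>GL\<^esub> y) (case p of (x, y) \<Rightarrow> x \<otimes>\<^bsub>GL\<^esub> y) F"
      by (simp add: limitin_GL_topology mult_GL case_prod_unfold tendsto_matrix_mult invertible_mult)
  qed
  moreover have "continuous_map GL_topology GL_topology (\<lambda>x :: 'a ^ 'n ^ 'n. inv\<^bsub>GL\<^esub> x)"
  proof (rule continuous_map_if_limitin)
    fix A :: "'a ^ 'n ^ 'n" and F
    assume lim: "limitin GL_topology (\<lambda>y. y) A F"
    have inv: "invertible (inv\<^bsub>GL\<^esub> X)" "X ** inv\<^bsub>GL\<^esub> X = mat 1" if "invertible X" for X :: "'a ^ 'n ^ 'n"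
      using inv_closed[of X] r_inv[of X] that by (simp_all add: carrier_GL mult_GL one_GL)
    show "limitin GL_topology (\<lambda>x. inv\<^bsub>GL\<^esub> x) (inv\<^bsub>GL\<^esub> A) F"
      using lim unfolding limitin_GL_topology
      by (auto simp: inv elim: eventually_mono intro!: tendsto_inverse_matrix[of "\<lambda>x. x" A])
  qed
  ultimately show ?thesis
    unfolding topological_group_def by (simp add: is_group GL_topology_def)
qed

section \<open>Minimality of images of GL\<close>

lemma mat_mult_commute: "mat c ** A = A ** mat c"
  for A :: "'a::comm_semiring_1 ^ 'n ^ 'n"
  by (simp add: vec_eq_iff mat_mult_nth)
    (simp add: matrix_matrix_mult_def mat_def if_distrib[of "\<lambda>x. _ * x"] mult.commute cong: if_cong)

lemma mat_mult_mat: "mat c ** mat d = mat (c * d)"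
  for c d :: "'a::comm_semiring_1"
  by (simp add: vec_eq_iff mat_mult_nth) (simp add: mat_def)

lemma invertible_mat: "c \<noteq> 0 \<Longrightarrow> invertible (mat c)" for c :: "'a::field"
  unfolding invertible_def by (intro exI[of _ "mat (inverse c)"]) (simp add: mat_mult_mat)

lemma invertible_if_mult_eq_mat:
  fixes A :: "'a::field ^ 'n ^ 'n"
  assumes "A ** B = mat c" "c \<noteq> 0"
  shows "invertible A"
  unfolding invertible_right_inverse
proof
  show "A ** (B ** mat (inverse c)) = mat 1"
    by (simp add: matrix_mul_assoc assms mat_mult_mat)
qed

lemma matrix_nonzero_mult_vector:
  fixes A :: "'a::comm_ring_1 ^ 'n ^ 'm"
  assumes "A \<noteq> 0"
  obtains u v where "A *v u \<noteq> 0" "v v* A \<noteq> 0"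
proof -
  obtain i j where "A $ i $ j \<noteq> 0"
    using assms by (auto simp: vec_eq_iff)
  then have "(A *v axis j 1) $ i \<noteq> 0" "(axis i 1 v* A) $ j \<noteq> 0"
    by (simp_all add: matrix_vector_mult_axis vector_matrix_mult_axis)
  then show thesis
    by (intro that[of "axis j 1" "axis i 1"]) auto
qed

text \<open>Let \<open>g\<close> run through matrices with \<open>h g \<rightarrow> q\<close> in the coarser topology, and rescale \<open>g\<close> and
  \<open>g\<inverse>\<close> to matrices \<open>g\<close> and \<open>k\<close> in a compact set not containing \<open>0\<close>, with limits \<open>A\<close> and \<open>B\<close> and \<open>g k = c\<close>. If \<open>A\<close>
  is singular then \<open>c \<rightarrow> 0\<close>, and conjugating \<open>1 + c u v\<^sup>T \<rightarrow> 1\<close> by \<open>g\<close> gives a matrix tending to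
  the transvection \<open>1 + (A u) (v\<^sup>T B)\<close>, which is therefore in the kernel of \<open>h\<close>.\<close>

lemma minimal_group_GL_image:
  fixes Q :: "('q, 'r) monoid_scheme" (structure) and h :: "'a::local_field ^ 'n ^ 'n \<Rightarrow> 'q"
  assumes T: "topological_group Q T" and hom: "group_hom GL Q h"
    and surj: "h ` carrier GL = carrier Q" and cont: "continuous_map GL_topology T h"
    and scalar: "\<And>c. c \<noteq> 0 \<Longrightarrow> h (mat c) = \<one>"
  shows "minimal_group Q T"
proof -
  interpret h: group_hom GL Q h by (rule hom)
  have topT: "topspace T = carrier Q"
    using T by (simp add: topological_group_def)
  have "S = T" if S: "topological_group Q S" and coarser: "coarser_topology S T" for S
  proof -
    have topS: "topspace S = carrier Q" and HS: "Hausdorff_space S"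
      using S by (simp_all add: topological_group_def)
    have limS: "limitin S f l F" if "limitin T f l F" for f :: "'q \<Rightarrow> 'q" and l F
      using that coarser topS topT unfolding limitin_def coarser_topology_def by blast
    have lim_h: "limitin T (\<lambda>x. h (f x)) (h A) F"
      if "(f \<longlongrightarrow> A) F" "invertible A" "eventually (\<lambda>x. invertible (f x)) F"
      for f :: "'q \<Rightarrow> 'a ^ 'n ^ 'n" and A F
      using continuous_map_limit[OF cont, of f A F] that by (simp add: limitin_GL_topology o_def)
    obtain C :: "('a ^ 'n ^ 'n) set" where C: "compact C" "0 \<notin> C"
      and scale: "\<forall>A. A \<noteq> 0 \<longrightarrow> (\<exists>c. c \<noteq> 0 \<and> mat c ** A \<in> C)"
      by (rule matrix_projective_compact)
    define P where "P x g k c \<longleftrightarrow> g \<in> C \<and> k \<in> C \<and> c \<noteq> 0 \<and> g ** k = mat c \<and> k ** g = mat c \<and> h g = x"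
      for x g k c
    \<comment> \<open>A preimage of \<open>x\<close> and its inverse are scaled into
      \<open>C\<close> independently, so their product is a scalar that may tend to 0 as
      \<open>x\<close> varies.\<close>
    have "\<exists>g k c. P x g k c" if x: "x \<in> carrier Q" for x
    proof -
      have "x \<in> h ` {X. invertible X}"
        using x surj by (simp add: carrier_GL)
      then obtain X where X: "invertible X" "h X = x"
        by blast
      then obtain Y where Y: "X ** Y = mat 1" "Y ** X = mat 1"
        unfolding invertible_def by blast
      have "mat 1 \<noteq> (0 :: 'a ^ 'n ^ 'n)"
        by (simp add: vec_eq_iff mat_def)
      then have "X \<noteq> 0" "Y \<noteq> 0"
        using Y by auto
      then obtain c d where cd: "c \<noteq> 0" "mat c ** X \<in> C" "d \<noteq> 0" "mat d ** Y \<in> C"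
        using scale by meson
      have "(mat c ** X) ** (mat d ** Y) = mat c ** (X ** mat d) ** Y"
        by (simp add: matrix_mul_assoc)
      also have "\<dots> = mat c ** mat d ** (X ** Y)"
        by (simp add: matrix_mul_assoc flip: mat_mult_commute[of d X])
      finally have "(mat c ** X) ** (mat d ** Y) = mat (c * d)"
        by (simp add: Y mat_mult_mat)
      moreover have "(mat d ** Y) ** (mat c ** X) = mat d ** (Y ** mat c) ** X"
        by (simp add: matrix_mul_assoc)
      then have "(mat d ** Y) ** (mat c ** X) = mat d ** mat c ** (Y ** X)"
        by (simp add: matrix_mul_assoc flip: mat_mult_commute[of c Y])
      then have "(mat d ** Y) ** (mat c ** X) = mat (c * d)"
        by (simp add: Y mat_mult_mat mult.commute)
      moreover have "h (mat c ** X) = x"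
        using X cd x by (simp add: hom_GL_mult[OF hom] invertible_mat scalar)
      ultimately have "P x (mat c ** X) (mat d ** Y) (c * d)"
        using cd by (simp add: P_def)
      then show ?thesis by blast
    qed
    then obtain g k c where "\<And>x. x \<in> carrier Q \<Longrightarrow> P x (g x) (k x) (c x)"
      by metis
    then have gkc: "g x \<in> C \<and> k x \<in> C \<and> c x \<noteq> 0 \<and>
        g x ** k x = mat (c x) \<and> k x ** g x = mat (c x) \<and> h (g x) = x" if "x \<in> carrier Q" for x
      using that by (simp add: P_def)
    have inv_g: "invertible (g x)" and inv_k: "invertible (k x)" if "x \<in> carrier Q" for x
      using gkc[OF that] invertible_if_mult_eq_mat by blast+
    have "openin S U" if U: "openin T U" for U
    proof (subst openin_subopen, rule ballI, rule ccontr)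
      fix q assume "q \<in> U" and no: "\<not> (\<exists>V. openin S V \<and> q \<in> V \<and> V \<subseteq> U)"
      have q: "q \<in> carrier Q"
        using \<open>q \<in> U\<close> openin_subset[OF U] topT by blast
      \<comment> \<open>If no \<open>S\<close>-neighbourhood of \<open>q\<close> lies in
        \<open>U\<close>, this filter is proper; along it, points tend to \<open>q\<close> in
        \<open>S\<close> but avoid \<open>U\<close>.\<close>
      define F where "F = inf (nhdsin S q) (principal (carrier Q - U))"
      have "F \<noteq> bot"
      proof
        assume "F = bot"
        then have "eventually (\<lambda>x. x \<notin> carrier Q - U) (nhdsin S q)"
          by (simp add: F_def flip: eventually_False add: eventually_inf_principal)
        then obtain V where V: "openin S V" "q \<in> V" "\<forall>x\<in>V. x \<notin> carrier Q - U"
          using q topS by (auto simp: eventually_nhdsin)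
        then have "V \<subseteq> U"
          using openin_subset[OF V(1)] topS by blast
        with V no show False by blast
      qed
      have F_q: "limitin S (\<lambda>x. x) q F'" if "F' \<le> F" for F'
        unfolding limitin_def
      proof (intro conjI allI impI)
        show "q \<in> topspace S" using q topS by simp
      next
        fix V assume "openin S V \<and> q \<in> V"
        then have "eventually (\<lambda>x. x \<in> V) (nhdsin S q)"
          using q topS by (auto simp: eventually_nhdsin)
        then have "eventually (\<lambda>x. x \<in> V) F"
          unfolding F_def by (rule filter_leD[OF inf_le1])
        with that show "eventually (\<lambda>x. x \<in> V) F'" by (rule filter_leD)
      qed
      have F_ev: "eventually (\<lambda>x. x \<in> carrier Q \<and> x \<notin> U) F'" if "F' \<le> F" for F'
        by (rule filter_leD[OF that]) (simp add: F_def eventually_inf_principal)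
      have F_carr: "eventually (\<lambda>x. x \<in> carrier Q) F'" if "F' \<le> F" for F'
        using F_ev[OF that] by (rule eventually_mono) simp
      have F_U: "eventually (\<lambda>x. x \<notin> U) F'" if "F' \<le> F" for F'
        using F_ev[OF that] by (rule eventually_mono) simp
      \<comment> \<open>Representatives cannot have an invertible limit \<open>A\<close>: the points
        would tend to \<open>h A\<close> in \<open>T\<close>, hence in \<open>S\<close>, so
        \<open>h A = q\<close> and they would enter \<open>U\<close>.\<close>
      have no_limit: False
        if F': "F' \<noteq> bot" "F' \<le> F" and f: "(f \<longlongrightarrow> A) F'" "invertible A"
          and ev: "\<And>x. x \<in> carrier Q \<Longrightarrow> invertible (f x) \<and> h (f x) = x" for f A F'
      proof -
        have "eventually (\<lambda>x. invertible (f x)) F'" and eq: "eventually (\<lambda>x. h (f x) = x) F'"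
          using F_carr[OF F'(2)] ev by (auto elim: eventually_mono)
        then have "limitin T (\<lambda>x. h (f x)) (h A) F'"
          by (intro lim_h f)
        from limitin_transform_eventually[OF eq this]
        have lim: "limitin T (\<lambda>x. x) (h A) F'" .
        have "h A = q"
          using limitin_Hausdorff_unique[OF limS[OF lim] F_q[OF F'(2)] _ HS] F'(1) by simp
        with lim U \<open>q \<in> U\<close> have "eventually (\<lambda>x. x \<in> U) F'"
          unfolding limitin_def by blast
        with F_U[OF F'(2)] have "eventually (\<lambda>x. False) F'"
          by eventually_elim simp
        with F'(1) show False by (simp add: eventually_False)
      qed
      have "eventually (\<lambda>x. g x \<in> C) F"
        using F_carr[OF order_refl] by (rule eventually_mono) (simp add: gkc)
      then obtain A F1 where A: "A \<in> C" and F1: "F1 \<noteq> bot" "F1 \<le> F" "(g \<longlongrightarrow> A) F1"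
        by (rule compact_obtain_subfilter[OF C(1) \<open>F \<noteq> bot\<close>])
      have "eventually (\<lambda>x. k x \<in> C) F1"
        using F_carr[OF F1(2)] by (rule eventually_mono) (simp add: gkc)
      then obtain B G where B: "B \<in> C" and G: "G \<noteq> bot" "G \<le> F1" and k_lim: "(k \<longlongrightarrow> B) G"
        by (rule compact_obtain_subfilter[OF C(1) F1(1)])
      have GF: "G \<le> F"
        using G(2) F1(2) by (rule order_trans)
      have g_lim: "(g \<longlongrightarrow> A) G"
        by (rule tendsto_mono[OF G(2) F1(3)])
      note G_carr = F_carr[OF GF]
      \<comment> \<open>An arbitrary index: it reads the limit of the scalars off the diagonal, and
        later marks the place of the entry in diagonal representatives.\<close>
      fix i0 :: 'n
      define c0 where "c0 = (A ** B) $ i0 $ i0"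
      have gk_lim: "((\<lambda>x. g x ** k x) \<longlongrightarrow> A ** B) G" and kg_lim: "((\<lambda>x. k x ** g x) \<longlongrightarrow> B ** A) G"
        by (intro tendsto_matrix_mult g_lim k_lim)+
      have gk_eq: "eventually (\<lambda>x. (g x ** k x) $ i $ j = (mat (c x) :: 'a ^ 'n ^ 'n) $ i $ j) G"
        and kg_eq: "eventually (\<lambda>x. (k x ** g x) $ i $ j = (mat (c x) :: 'a ^ 'n ^ 'n) $ i $ j) G" for i j
        using G_carr by (auto elim!: eventually_mono simp: gkc)
      have "((\<lambda>x. (mat (c x) :: 'a ^ 'n ^ 'n) $ i0 $ i0) \<longlongrightarrow> c0) G"
        unfolding c0_def
        by (rule Lim_transform_eventually[OF _ gk_eq]) (intro tendsto_vec_nth gk_lim)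
      then have c_lim: "(c \<longlongrightarrow> c0) G"
        by (simp add: mat_def)
      have mat_lim: "((\<lambda>x. (mat (c x) :: 'a ^ 'n ^ 'n) $ i $ j) \<longlongrightarrow> mat c0 $ i $ j) G" for i j
        by (simp add: mat_def c_lim)
      have AB: "A ** B = mat c0"
        unfolding vec_eq_iff
      proof (intro allI)
        fix i j
        have "((\<lambda>x. (mat (c x) :: 'a ^ 'n ^ 'n) $ i $ j) \<longlongrightarrow> (A ** B) $ i $ j) G"
          by (rule Lim_transform_eventually[OF _ gk_eq]) (intro tendsto_vec_nth gk_lim)
        from tendsto_unique[OF G(1) this mat_lim] show "(A ** B) $ i $ j = mat c0 $ i $ j" .
      qed
      have BA: "B ** A = mat c0"
        unfolding vec_eq_iff
      proof (intro allI)
        fix i j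
        have "((\<lambda>x. (mat (c x) :: 'a ^ 'n ^ 'n) $ i $ j) \<longlongrightarrow> (B ** A) $ i $ j) G"
          by (rule Lim_transform_eventually[OF _ kg_eq]) (intro tendsto_vec_nth kg_lim)
        from tendsto_unique[OF G(1) this mat_lim] show "(B ** A) $ i $ j = mat c0 $ i $ j" .
      qed
      have "c0 = 0"
      proof (rule ccontr)
        assume "c0 \<noteq> 0"
        with AB have "invertible A" by (rule invertible_if_mult_eq_mat)
        from no_limit[OF G(1) GF g_lim this] show False
          using gkc inv_g by blast
      qed
      have "A \<noteq> 0" "B \<noteq> 0"
        using A B C(2) by auto
      then obtain u v where uv: "A *v u \<noteq> 0" "v v* B \<noteq> 0"
        using matrix_nonzero_mult_vector by metis
      \<comment> \<open>\<open>mat (c x) ** f x\<close> equals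
        \<open>g x ** one_plus_outer (c x *s u) v ** k x\<close>. As \<open>h\<close> kills scalars,
        \<open>h (f x)\<close> is the image of the middle factor conjugated by
        \<open>x\<close>.\<close>
      define f where "f x = one_plus_outer (g x *v u) (v v* k x)" for x
      \<comment> \<open>\<open>B ** A\<close> is zero, so the limit of \<open>f\<close> is a
        transvection, nontrivial by the choice of \<open>u\<close> and \<open>v\<close>.\<close>
      have "dotp (v v* B) (A *v u) = dotp v ((B ** A) *v u)"
        by (simp add: dotp_matrix_vector flip: matrix_vector_mul_assoc)
      also have "\<dots> = 0"
        by (simp add: BA \<open>c0 = 0\<close> mat_0)
      finally have ab: "dotp (v v* B) (A *v u) = 0" .
      have "((\<lambda>x. 1 + c x * dotp v u) \<longlongrightarrow> 1 + c0 * dotp v u) G"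
        by (intro tendsto_add tendsto_mult tendsto_const c_lim)
      then have "eventually (\<lambda>x. 1 + c x * dotp v u \<noteq> 0) G"
        by (rule tendsto_imp_eventually_ne) (simp add: \<open>c0 = 0\<close>)
      with G_carr have ev: "eventually (\<lambda>x. invertible (one_plus_outer (c x *s u) v) \<and> invertible (f x) \<and>
          h (f x) = x \<otimes> h (one_plus_outer (c x *s u) v) \<otimes> inv x) G"
      proof eventually_elim
        fix x assume x: "x \<in> carrier Q" and nz: "1 + c x * dotp v u \<noteq> 0"
        let ?R = "one_plus_outer (c x *s u) v"
        have R: "invertible ?R"
          by (rule invertible_one_plus_outer) (simp add: nz dotp_scale_right)
        have "dotp (v v* k x) (g x *v u) = dotp v ((k x ** g x) *v u)"
          by (simp add: dotp_matrix_vector flip: matrix_vector_mul_assoc)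
        also have "(k x ** g x) *v u = c x *s u"
          using gkc[OF x] by (simp add: vec_eq_iff matrix_vector_mult_def mat_def
              if_distrib[of "\<lambda>x. x * _"] cong: if_cong)
        finally have f: "invertible (f x)"
          unfolding f_def by (intro invertible_one_plus_outer) (simp add: nz dotp_scale_right)
        have "g x ** ?R ** k x = mat (c x) + outer (g x *v (c x *s u)) (v v* k x)"
          using gkc[OF x]
          by (simp add: one_plus_outer_def matrix_add_ldistrib matrix_mult_add_rdistrib
              matrix_mult_outer outer_mult_matrix)
        also have "\<dots> = mat (c x) ** f x"
          unfolding f_def one_plus_outer_def outer_def
          by (simp add: vec_eq_iff mat_mult_nth)
            (simp add: mat_def matrix_vector_mult_def sum_distrib_left distrib_left mult_ac)
        finally have "h (g x ** ?R ** k x) = h (mat (c x) ** f x)"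
          by simp
        then have "h (f x) = x \<otimes> h ?R \<otimes> h (k x)"
          using gkc[OF x] inv_g[OF x] inv_k[OF x] R f
          by (simp add: hom_GL_mult[OF hom] invertible_mult invertible_mat scalar hom_GL_closed[OF hom])
        moreover have "h (k x) \<otimes> x = \<one>"
          using gkc[OF x] inv_g[OF x] inv_k[OF x] hom_GL_mult[OF hom, of "k x" "g x"]
          by (simp add: scalar)
        then have "h (k x) = inv x"
          using x hom_GL_closed[OF hom inv_k[OF x]] by (metis h.H.inv_equality)
        ultimately show "invertible ?R \<and> invertible (f x) \<and> h (f x) = x \<otimes> h ?R \<otimes> inv x"
          using R f by simp
      qed
      have "((\<lambda>x. c x *s u) \<longlongrightarrow> c0 *s u) G"
        unfolding vector_scalar_mult_def
        by (intro tendsto_vec_lambda tendsto_mult c_lim tendsto_const)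
      then have "((\<lambda>x. one_plus_outer (c x *s u) v) \<longlongrightarrow> one_plus_outer (c0 *s u) v) G"
        by (intro tendsto_one_plus_outer tendsto_const)
      then have "((\<lambda>x. one_plus_outer (c x *s u) v) \<longlongrightarrow> mat 1) G"
        by (simp add: \<open>c0 = 0\<close>)
      then have "limitin T (\<lambda>x. h (one_plus_outer (c x *s u) v)) (h (mat 1)) G"
        by (rule lim_h) (use ev in \<open>auto elim: eventually_mono simp: invertible_def[of "mat 1"] intro: exI[of _ "mat 1"]\<close>)
      \<comment> \<open>Since \<open>x\<close> tends to \<open>q\<close> only in \<open>S\<close>,
        the conjugates of elements tending to the identity are followed in \<open>S\<close>.\<close>
      then have "limitin S (\<lambda>x. x \<otimes> h (one_plus_outer (c x *s u) v) \<otimes> inv x) (q \<otimes> h (mat 1) \<otimes> inv q) G"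
        by (intro topological_group_limitin_mult[OF S] topological_group_limitin_inv[OF S] F_q[OF GF] limS)
      moreover have "eventually (\<lambda>x. x \<otimes> h (one_plus_outer (c x *s u) v) \<otimes> inv x = h (f x)) G"
        using ev by eventually_elim simp
      ultimately have "limitin S (\<lambda>x. h (f x)) (q \<otimes> h (mat 1) \<otimes> inv q) G"
        by (rule limitin_transform_eventually[rotated])
      moreover have "limitin T (\<lambda>x. h (f x)) (h (one_plus_outer (A *v u) (v v* B))) G"
      proof (rule lim_h)
        show "(f \<longlongrightarrow> one_plus_outer (A *v u) (v v* B)) G"
          unfolding f_def
          by (intro tendsto_one_plus_outer tendsto_matrix_vector_mult tendsto_vector_matrix_mult g_lim k_lim)
        show "invertible (one_plus_outer (A *v u) (v v* B))"
          by (rule invertible_one_plus_outer) (simp add: ab)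
        show "eventually (\<lambda>x. invertible (f x)) G"
          using ev by eventually_elim simp
      qed
      \<comment> \<open>The limit in \<open>T\<close> is also a limit in \<open>S\<close>, and
        limits in the Hausdorff topology \<open>S\<close> are unique.\<close>
      ultimately have "h (one_plus_outer (A *v u) (v v* B)) = q \<otimes> h (mat 1) \<otimes> inv q"
        using limitin_Hausdorff_unique[OF limS _ _ HS] G(1) by simp
      then have "h (one_plus_outer (A *v u) (v v* B)) = \<one>"
        using q by (simp add: hom_GL_one[OF hom])
      then have transvections: "h (one_plus_outer u v) = \<one>" if "dotp v u = 0" for u v
        using kills_transvections[OF hom _ uv ab that] by simp
      obtain D :: "'a set" where D: "compact D" "0 \<notin> D"
        and scale_D: "\<forall>x. x \<noteq> 0 \<longrightarrow> (\<exists>y. y \<noteq> 0 \<and> y ^ CARD('n) * x \<in> D)"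
        by (rule units_mod_powers_compact[OF zero_less_card_finite])
      let ?d = "\<lambda>z. one_plus_outer (axis i0 (z - 1)) (axis i0 1) :: 'a ^ 'n ^ 'n"
      have inv_d: "invertible (?d z)" if "z \<noteq> 0" for z
        by (rule invertible_one_plus_outer) (simp add: that)
      \<comment> \<open>New representatives: diagonal matrices with one entry in \<open>D\<close>.
        Since \<open>D\<close> is compact and omits 0, they have an invertible cluster point, and
        \<open>no_limit\<close> applies again.\<close>
      have "\<exists>z\<in>D. h (?d z) = x" if x: "x \<in> carrier Q" for x
      proof -
        obtain z where z: "z \<noteq> 0" "h (g x) = h (?d z)"
          using hom_GL_eq_hom_one_plus_outer_axis[OF hom transvections inv_g[OF x]] by blast
        obtain y where y: "y \<noteq> 0" "y ^ CARD('n) * z \<in> D"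
          using scale_D z(1) by blast
        have "h (?d (y ^ CARD('n) * z)) = h (?d z)"
          by (rule hom_one_plus_outer_axis_power[OF hom transvections scalar]) (use y z in auto)
        with y z gkc[OF x] show ?thesis by auto
      qed
      then obtain z where z: "\<And>x. x \<in> carrier Q \<Longrightarrow> z x \<in> D \<and> h (?d (z x)) = x"
        by metis
      have "eventually (\<lambda>x. z x \<in> D) G"
        using G_carr by (rule eventually_mono) (simp add: z)
      then obtain z0 G' where z0: "z0 \<in> D" and G': "G' \<noteq> bot" "G' \<le> G" "(z \<longlongrightarrow> z0) G'"
        by (rule compact_obtain_subfilter[OF D(1) G(1)])
      have d_lim: "((\<lambda>x. ?d (z x)) \<longlongrightarrow> ?d z0) G'"
      proof (intro tendsto_one_plus_outer tendsto_const vec_tendstoI)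
        fix i
        show "((\<lambda>x. axis i0 (z x - 1) $ i) \<longlongrightarrow> axis i0 (z0 - 1) $ i) G'"
          unfolding axis_component
          by (cases "i = i0") (simp_all add: tendsto_diff G'(3))
      qed
      have d_eq: "invertible (?d (z x)) \<and> h (?d (z x)) = x" if "x \<in> carrier Q" for x
      proof -
        have "z x \<noteq> 0" using z[OF that] D(2) by metis
        with z[OF that] inv_d show ?thesis by simp
      qed
      have "z0 \<noteq> 0" using z0 D(2) by metis
      then have "invertible (?d z0)" by (rule inv_d)
      then show False
        using no_limit[OF G'(1) order_trans[OF G'(2) GF] d_lim _ d_eq] by simp
    qed
    then show "S = T"
      using coarser unfolding topology_eq coarser_topology_def by blast
  qed
  with T show ?thesis
    unfolding minimal_group_def by blast
qed

section \<open>Application to PGL\<close>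

lemma quotient_group_hom:
  assumes "N \<lhd> G"
  shows "group_hom G (G Mod N) (\<lambda>x. N #>\<^bsub>G\<^esub> x)"
  using assms normal.r_coset_hom_Mod[OF assms] normal.factorgroup_is_group[OF assms]
  by (simp add: group_hom_def group_hom_axioms_def normal_def)

text \<open>Every Hausdorff quotient of PGL is the image of GL under a composite of two projections,
  which kills the scalar matrices because they are central.\<close>

theorem theorem4p11:
  shows "totally_minimal_group (PGL :: ('a::local_field ^ 'n ^ 'n) set monoid) PGL_topology"
  unfolding totally_minimal_group_def
proof (intro conjI allI impI)
  let ?GL = "GL :: ('a ^ 'n ^ 'n) monoid"
  let ?Z = "group_center ?GL"
  let ?P = "PGL :: ('a ^ 'n ^ 'n) set monoid"
  have Z: "?Z \<lhd> ?GL"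
    by (rule group.group_center_normal[OF group_GL])
  show P: "topological_group ?P PGL_topology"
    unfolding PGL_def PGL_topology_def
    by (rule topological_group_quotient[OF topological_group_GL Z closedin_group_center[OF topological_group_GL]])
  fix N assume "N \<lhd> ?P \<and> closedin PGL_topology N"
  then have N: "N \<lhd> ?P" "closedin PGL_topology N" by auto
  let ?h = "\<lambda>A. N #>\<^bsub>?P\<^esub> (?Z #>\<^bsub>?GL\<^esub> A)"
  have homZ: "group_hom ?GL ?P (\<lambda>A. ?Z #>\<^bsub>?GL\<^esub> A)"
    unfolding PGL_def by (rule quotient_group_hom[OF Z])
  have homN: "group_hom ?P (?P Mod N) (\<lambda>X. N #>\<^bsub>?P\<^esub> X)"
    by (rule quotient_group_hom[OF N(1)])
  show "minimal_group (?P Mod N) (quotient_group_topology ?P PGL_topology N)"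
  proof (rule minimal_group_GL_image)
    show "topological_group (?P Mod N) (quotient_group_topology ?P PGL_topology N)"
      by (rule topological_group_quotient[OF P N])
    show "group_hom ?GL (?P Mod N) ?h"
      using homZ homN Group.hom_compose[of "\<lambda>A. ?Z #>\<^bsub>?GL\<^esub> A" ?GL ?P "\<lambda>X. N #>\<^bsub>?P\<^esub> X" "?P Mod N"]
      by (simp add: group_hom_def group_hom_axioms_def o_def)
    show "?h ` carrier ?GL = carrier (?P Mod N)"
      by (simp add: carrier_FactGroup PGL_def image_image)
    have "continuous_map GL_topology PGL_topology (\<lambda>A. ?Z #>\<^bsub>?GL\<^esub> A)"
      unfolding PGL_topology_def by (rule continuous_map_quotient_group)
    from continuous_map_compose[OF this continuous_map_quotient_group[of PGL_topology ?P N]]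
    show "continuous_map GL_topology (quotient_group_topology ?P PGL_topology N) ?h"
      by (simp add: o_def)
    fix c :: 'a assume "c \<noteq> 0"
    then have "mat c \<in> ?Z"
      by (simp add: group_center_def carrier_GL mult_GL invertible_mat mat_mult_commute)
    then have "?Z #>\<^bsub>?GL\<^esub> mat c = \<one>\<^bsub>?P\<^esub>"
      using Z by (simp add: PGL_def group.coset_join2[OF group_GL] normal_imp_subgroup
          group_center_def)
    then show "?h (mat c) = \<one>\<^bsub>?P Mod N\<^esub>"
      using group_hom.hom_one[OF homN] by simp
  qed
qed

end
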